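(* Let $N\ge1$, $M\ge2$, let $\Omega\subset\mathbb{R}^N$ be open with smooth boundary, $0<p<2/(N-2)^+$, $\omega_1,\dots,\omega_M>0$, and let $K=(k_{ij})$ be a real symmetric $M\times M$ matrix. Let $U=(U_1,\dots,U_M)$ be a semitrivial bound-state of $$\Delta u_i-\omega_iu_i+\sum_{j=1}^M k_{ij}|u_j|^{p+1}|u_i|^{p-1}u_i=0\ \text{ on }\Omega,\qquad i=1,\dots,M,$$ and let $P\subset\{1,\dots,M\}^2$ be a nonempty symmetric subset with $k_{ij}>0$ for all $(i,j)\in P$ and such that $$(i,j)\in P\ \Rightarrow\ U_iU_j\equiv0.$$ For $\beta\in\mathbb{R}$ let $G_\beta$ be the set of ground-states of the system $$\Delta u_i-\omega_iu_i+\sum_{j:(i,j)\notin P}k_{ij}|u_j|^{p+1}|u_i|^{p-1}u_i+\sum_{j:(i,j)\in P}\beta k_{ij}|u_j|^{p+1}|u_i|^{p-1}u_i=0,\qquad i=1,\dots,M.$$ Then there is $\beta_0$ such that $U\notin G_\beta$ for all $\beta>\beta_0$.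
   Context: Convention: $2/(N-2)^+=+\infty$ if $N=1,2$ and $2/(N-2)^+=2/(N-2)$ if $N\ge3$. Functions in $H^1_0(\Omega)$ are complex-valued; $|u|^{p-1}u$ is taken to be $0$ where $u=0$. $P$ symmetric means $(i,j)\in P\Leftrightarrow(j,i)\in P$; diagonal pairs are allowed. A bound-state of a system of this type is an element of $(H^1_0(\Omega))^M\setminus\{0\}$ solving it; it is nontrivial if all its components are nonzero functions, and semitrivial otherwise. Put $$I(U)=\sum_{i=1}^M\int_\Omega\left(|\nabla u_i|^2+\omega_i|u_i|^2\right),$$ $$J_\beta(U)=\sum_{(i,j)\notin P}k_{ij}\int_\Omega|u_i|^{p+1}|u_j|^{p+1}+\beta\sum_{(i,j)\in P}k_{ij}\int_\Omega|u_i|^{p+1}|u_j|^{p+1},\quad S_\beta(U)=\tfrac12I(U)-\tfrac1{2p+2}J_\beta(U).$$ $G_\beta$ is the set of ground-states of the $\beta$-system, i.e. bound-states $U$ with $S_\beta(U)\le S_\beta(W)$ for every bound-state $W$ of the same system. Standing assumptions: for the systems considered there is $U$ with $J_\beta(U)>0$ (P1), and $G_\beta\ne\emptyset$ (Exist). Standing fact recalled by the paper from earlier work: under these, $G_\beta$ is exactly the set of solutions of $I(U)=\min_{J_\beta(W)=\lambda}I(W)$, $J_\beta(U)=\lambda$, where $\lambda=\left(\inf_{J_\beta(W)=1}I(W)\right)^{(p+1)/p}$. *)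

theory Defs
  imports "HOL-Analysis.Analysis"
begin

text \<open>Functions on \<open>\<Omega>\<close> are represented by functions on the whole space; only their values
  almost everywhere on \<open>\<Omega>\<close> matter. In particular a function is zero (in \<open>H\<^sup>1\<^sub>0(\<Omega>)\<close>) iff it vanishes
  almost everywhere on \<open>\<Omega>\<close>. The space dimension is \<open>N = CARD('n)\<close>, the number of components
  is \<open>M = CARD('m)\<close>.\<close>

section \<open>Smooth functions and domains with smooth boundary\<close>

primrec C_k :: "nat \<Rightarrow> ('a::euclidean_space \<Rightarrow> 'b::real_normed_vector) \<Rightarrow> bool" where
  "C_k 0 f \<longleftrightarrow> continuous_on UNIV f"
| "C_k (Suc k) f \<longleftrightarrow> (\<forall>x. f differentiable (at x)) \<and>
     (\<forall>b\<in>Basis. C_k k (\<lambda>x. frechet_derivative f (at x) b))"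

definition smooth :: "('a::euclidean_space \<Rightarrow> 'b::real_normed_vector) \<Rightarrow> bool" where
  "smooth f \<longleftrightarrow> (\<forall>k. C_k k f)"

text \<open>Near each boundary point, \<open>\<Omega>\<close> is the strict epigraph, in some direction \<open>e\<close>, of a smooth
  function \<open>\<gamma>\<close> of the coordinates orthogonal to \<open>e\<close>. A smooth function on the hyperplane
  orthogonal to \<open>e\<close> is represented by a smooth function on the whole space, of which only the
  restriction to the hyperplane is used.\<close>

definition smooth_boundary :: "(real^'n) set \<Rightarrow> bool" where
  "smooth_boundary \<Omega> \<longleftrightarrow>
     (\<forall>x0\<in>frontier \<Omega>. \<exists>e r. \<exists>\<gamma> :: real^'n \<Rightarrow> real. norm e = 1 \<and> r > 0 \<and> smooth \<gamma> \<and>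
        \<Omega> \<inter> ball x0 r = {x \<in> ball x0 r. \<gamma> (x - (x \<bullet> e) *\<^sub>R e) < x \<bullet> e})"

definition test_function :: "(real^'n) set \<Rightarrow> (real^'n \<Rightarrow> complex) \<Rightarrow> bool" where
  "test_function \<Omega> \<phi> \<longleftrightarrow> smooth \<phi> \<and> compact (closure {x. \<phi> x \<noteq> 0}) \<and> closure {x. \<phi> x \<noteq> 0} \<subseteq> \<Omega>"

definition grad :: "(real^'n \<Rightarrow> complex) \<Rightarrow> real^'n \<Rightarrow> complex^'n" where
  "grad \<phi> x = (\<chi> l. frechet_derivative \<phi> (at x) (axis l 1))"

section \<open>The space \<open>H\<^sup>1\<^sub>0(\<Omega>)\<close>\<close>

definition L2_on :: "(real^'n) set \<Rightarrow> (real^'n \<Rightarrow> 'b::euclidean_space) \<Rightarrow> bool" where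
  "L2_on \<Omega> f \<longleftrightarrow> f \<in> borel_measurable (lebesgue_on \<Omega>) \<and>
     integrable (lebesgue_on \<Omega>) (\<lambda>x. (norm (f x))\<^sup>2)"

definition is_weak_grad ::
    "(real^'n) set \<Rightarrow> (real^'n \<Rightarrow> complex) \<Rightarrow> (real^'n \<Rightarrow> complex^'n) \<Rightarrow> bool" where
  "is_weak_grad \<Omega> u g \<longleftrightarrow> L2_on \<Omega> g \<and>
     (\<forall>\<phi> l. test_function \<Omega> \<phi> \<longrightarrow>
        (LINT x|lebesgue_on \<Omega>. u x * (grad \<phi> x $ l)) = - (LINT x|lebesgue_on \<Omega>. (g x $ l) * \<phi> x))"

definition H1 :: "(real^'n) set \<Rightarrow> (real^'n \<Rightarrow> complex) set" where
  "H1 \<Omega> = {u. L2_on \<Omega> u \<and> (\<exists>g. is_weak_grad \<Omega> u g)}"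

text \<open>A chosen representative of the weak gradient, which is unique up to null sets.\<close>

definition weak_grad :: "(real^'n) set \<Rightarrow> (real^'n \<Rightarrow> complex) \<Rightarrow> real^'n \<Rightarrow> complex^'n" where
  "weak_grad \<Omega> u = (SOME g. is_weak_grad \<Omega> u g)"

text \<open>The closure of the test functions in the \<open>H\<^sup>1\<close> norm.\<close>

definition H10 :: "(real^'n) set \<Rightarrow> (real^'n \<Rightarrow> complex) set" where
  "H10 \<Omega> = {u \<in> H1 \<Omega>. \<exists>\<phi> :: nat \<Rightarrow> real^'n \<Rightarrow> complex. (\<forall>n. test_function \<Omega> (\<phi> n)) \<and>
     (\<lambda>n. LINT x|lebesgue_on \<Omega>. (norm (u x - \<phi> n x))\<^sup>2) \<longlonglongrightarrow> 0 \<and>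
     (\<lambda>n. LINT x|lebesgue_on \<Omega>. (norm (weak_grad \<Omega> u x - grad (\<phi> n) x))\<^sup>2) \<longlonglongrightarrow> 0}"

definition H10_tuples :: "(real^'n) set \<Rightarrow> ('m::finite \<Rightarrow> real^'n \<Rightarrow> complex) set" where
  "H10_tuples \<Omega> = {U. \<forall>i. U i \<in> H10 \<Omega>}"

definition zero_on :: "(real^'n) set \<Rightarrow> (real^'n \<Rightarrow> complex) \<Rightarrow> bool" where
  "zero_on \<Omega> u \<longleftrightarrow> (AE x in lebesgue_on \<Omega>. u x = 0)"

section \<open>Systems with a general coupling matrix\<close>

text \<open>\<open>2/(N-2)\<^sup>+\<close>\<close>

definition critical_exponent :: "nat \<Rightarrow> ereal" where
  "critical_exponent N = (if N \<le> 2 then \<infinity> else ereal (2 / (real N - 2)))"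

text \<open>\<open>U\<close> solves
  \<open>\<Delta> u\<^sub>i - \<omega>\<^sub>i u\<^sub>i + (\<Sum>j. a\<^sub>i\<^sub>j |u\<^sub>j|\<^bsup>p+1\<^esup> |u\<^sub>i|\<^bsup>p-1\<^esup> u\<^sub>i) = 0\<close> on \<open>\<Omega>\<close> in the sense of distributions.
  Where \<open>u\<^sub>i = 0\<close> the factor \<open>|u\<^sub>i|\<^bsup>p-1\<^esup> u\<^sub>i\<close> evaluates to \<open>0\<close>, also for \<open>p \<le> 1\<close>.\<close>

definition weak_solution ::
    "(real^'n) set \<Rightarrow> real^'m \<Rightarrow> real \<Rightarrow> real^'m^'m \<Rightarrow> ('m::finite \<Rightarrow> real^'n \<Rightarrow> complex) \<Rightarrow> bool" where
  "weak_solution \<Omega> \<omega> p A U \<longleftrightarrow> (\<forall>i \<phi>. test_function \<Omega> \<phi> \<longrightarrow>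
     - (LINT x|lebesgue_on \<Omega>. (\<Sum>l\<in>UNIV. (weak_grad \<Omega> (U i) x $ l) * (grad \<phi> x $ l)))
     - of_real (\<omega> $ i) * (LINT x|lebesgue_on \<Omega>. U i x * \<phi> x)
     + (LINT x|lebesgue_on \<Omega>.
          (\<Sum>j\<in>UNIV. of_real (A $ i $ j * norm (U j x) powr (p + 1) * norm (U i x) powr (p - 1)) * U i x)
          * \<phi> x) = 0)"

definition bound_state ::
    "(real^'n) set \<Rightarrow> real^'m \<Rightarrow> real \<Rightarrow> real^'m^'m \<Rightarrow> ('m::finite \<Rightarrow> real^'n \<Rightarrow> complex) \<Rightarrow> bool" where
  "bound_state \<Omega> \<omega> p A U \<longleftrightarrow>
     U \<in> H10_tuples \<Omega> \<and> \<not> (\<forall>i. zero_on \<Omega> (U i)) \<and> weak_solution \<Omega> \<omega> p A U"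

definition semitrivial_bound_state ::
    "(real^'n) set \<Rightarrow> real^'m \<Rightarrow> real \<Rightarrow> real^'m^'m \<Rightarrow> ('m::finite \<Rightarrow> real^'n \<Rightarrow> complex) \<Rightarrow> bool" where
  "semitrivial_bound_state \<Omega> \<omega> p A U \<longleftrightarrow> bound_state \<Omega> \<omega> p A U \<and> (\<exists>i. zero_on \<Omega> (U i))"

definition I_fun :: "(real^'n) set \<Rightarrow> real^'m \<Rightarrow> ('m::finite \<Rightarrow> real^'n \<Rightarrow> complex) \<Rightarrow> real" where
  "I_fun \<Omega> \<omega> U = (\<Sum>i\<in>UNIV. LINT x|lebesgue_on \<Omega>.
     (norm (weak_grad \<Omega> (U i) x))\<^sup>2 + \<omega> $ i * (norm (U i x))\<^sup>2)"

definition J_fun :: "(real^'n) set \<Rightarrow> real \<Rightarrow> real^'m^'m \<Rightarrow> ('m::finite \<Rightarrow> real^'n \<Rightarrow> complex) \<Rightarrow> real" where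
  "J_fun \<Omega> p A U = (\<Sum>(i,j)\<in>UNIV. A $ i $ j *
     (LINT x|lebesgue_on \<Omega>. norm (U i x) powr (p + 1) * norm (U j x) powr (p + 1)))"

definition S_fun ::
    "(real^'n) set \<Rightarrow> real^'m \<Rightarrow> real \<Rightarrow> real^'m^'m \<Rightarrow> ('m::finite \<Rightarrow> real^'n \<Rightarrow> complex) \<Rightarrow> real" where
  "S_fun \<Omega> \<omega> p A U = 1 / 2 * I_fun \<Omega> \<omega> U - 1 / (2 * p + 2) * J_fun \<Omega> p A U"

definition ground_states ::
    "(real^'n) set \<Rightarrow> real^'m \<Rightarrow> real \<Rightarrow> real^'m^'m \<Rightarrow> ('m::finite \<Rightarrow> real^'n \<Rightarrow> complex) set" where
  "ground_states \<Omega> \<omega> p A = {U. bound_state \<Omega> \<omega> p A U \<and>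
     (\<forall>W. bound_state \<Omega> \<omega> p A W \<longrightarrow> S_fun \<Omega> \<omega> p A U \<le> S_fun \<Omega> \<omega> p A W)}"

text \<open>The level \<open>\<lambda>\<close> and the solutions of \<open>I(U) = min {I(W) | J(W) = \<lambda>}\<close>, \<open>J(U) = \<lambda>\<close>.\<close>

definition min_level :: "(real^'n) set \<Rightarrow> real^'m \<Rightarrow> real \<Rightarrow> real^'m^'m \<Rightarrow> real" where
  "min_level \<Omega> \<omega> p A =
     (INF W \<in> {W \<in> H10_tuples \<Omega>. J_fun \<Omega> p A W = 1}. I_fun \<Omega> \<omega> W) powr ((p + 1) / p)"

definition constrained_minimizers ::
    "(real^'n) set \<Rightarrow> real^'m \<Rightarrow> real \<Rightarrow> real^'m^'m \<Rightarrow> ('m::finite \<Rightarrow> real^'n \<Rightarrow> complex) set" where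
  "constrained_minimizers \<Omega> \<omega> p A =
     {U \<in> H10_tuples \<Omega>. J_fun \<Omega> p A U = min_level \<Omega> \<omega> p A \<and>
        (\<forall>W\<in>H10_tuples \<Omega>. J_fun \<Omega> p A W = min_level \<Omega> \<omega> p A \<longrightarrow> I_fun \<Omega> \<omega> U \<le> I_fun \<Omega> \<omega> W)}"

section \<open>The coupling matrix of the \<open>\<beta>\<close>-system\<close>

definition beta_coupling :: "real^'m^'m \<Rightarrow> ('m \<times> 'm) set \<Rightarrow> real \<Rightarrow> real^'m^'m" where
  "beta_coupling K P \<beta> = (\<chi> i j. if (i, j) \<in> P then \<beta> * K $ i $ j else K $ i $ j)"

lemma J_fun_beta_coupling:
  fixes P :: "('m::finite \<times> 'm) set"
  shows "J_fun \<Omega> p (beta_coupling K P \<beta>) U =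
     (\<Sum>(i,j)\<in>-P. K $ i $ j *
        (LINT x|lebesgue_on \<Omega>. norm (U i x) powr (p + 1) * norm (U j x) powr (p + 1)))
     + \<beta> * (\<Sum>(i,j)\<in>P. K $ i $ j *
        (LINT x|lebesgue_on \<Omega>. norm (U i x) powr (p + 1) * norm (U j x) powr (p + 1)))"
proof -
  let ?t = "\<lambda>z. beta_coupling K P \<beta> $ fst z $ snd z *
     (LINT x|lebesgue_on \<Omega>. norm (U (fst z) x) powr (p + 1) * norm (U (snd z) x) powr (p + 1))"
  have "J_fun \<Omega> p (beta_coupling K P \<beta>) U = sum ?t UNIV"
    by (simp add: J_fun_def case_prod_beta)
  also have "\<dots> = sum ?t (-P) + sum ?t P"
    by (subst sum.union_disjoint[symmetric]) auto
  finally show ?thesis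
    by (simp add: beta_coupling_def case_prod_beta sum_distrib_left mult.assoc)
qed

end

theory Submission
  imports Defs "HOL-Computational_Algebra.Polynomial"
begin

text \<open>Since \<open>U\<^sub>i U\<^sub>j = 0\<close> for all \<open>(i, j) \<in> P\<close>, the value \<open>c = J\<^sub>\<beta>(U)\<close> does not depend on \<open>\<beta>\<close>. If \<open>U\<close> is a
  ground state, then \<open>c\<close> must be equal to the level \<open>\<lambda>\<^sub>\<beta>\<close> of the constrained problem. But \<open>\<lambda>\<^sub>\<beta>\<close> tends to
  \<open>0\<close> as \<open>\<beta>\<close> tends to infinity: for the tuple \<open>W\<close> all of whose components are one nonzero test function
  \<open>\<phi>\<close>, the value \<open>J\<^sub>\<beta>(W)\<close> grows linearly in \<open>\<beta>\<close>, because the entries of the coupling matrix on \<open>P\<close> are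
  positive, while \<open>I(W)\<close> is fixed; rescaling \<open>W\<close> to \<open>J\<^sub>\<beta> = 1\<close> bounds \<open>\<lambda>\<^sub>\<beta>\<close> by a constant times
  \<open>J\<^sub>\<beta>(W)\<^bsup>-1/p\<^esup>\<close> (lemma \<open>min_level_le_test_function\<close>). So \<open>c > 0\<close> is impossible for large \<open>\<beta>\<close>, and
  \<open>c < 0\<close> is impossible because \<open>\<lambda>\<^sub>\<beta> \<ge> 0\<close>. If \<open>c = 0\<close>, the zero tuple satisfies the constraint, so
  minimality gives \<open>I(U) \<le> I(0) = 0\<close>, and \<open>U = 0\<close>, which a bound state is not.

  The argument needs to know that multiples of test functions lie in \<open>H\<^sup>1\<^sub>0(\<Omega>)\<close> and what \<open>I\<close> is on
  them, and this rests on two classical facts. Integration by parts (\<open>integral_by_parts\<close>) shows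
  that the classical gradient of a test function is a weak gradient. The uniqueness of weak gradients
  up to null sets (\<open>is_weak_grad_unique\<close>) is a case of the fundamental lemma of the calculus of
  variations (\<open>AE_eq_0_if_orthogonal_to_test_functions\<close>), which is proved by approximating
  indicators of boxes by smooth bumps made from the function \<open>exp(-1/t)\<close>.\<close>

section \<open>Calculus of smooth functions\<close>

lemma C_k_SucI:
  fixes f :: "'a::euclidean_space \<Rightarrow> 'b::real_normed_vector"
  assumes "\<And>x. (f has_derivative D x) (at x)" and "\<And>b. b \<in> Basis \<Longrightarrow> C_k k (\<lambda>x. D x b)"
  shows "C_k (Suc k) f"
proof -
  have "frechet_derivative f (at x) = D x" for x
    using frechet_derivative_at[OF assms(1)] by simp
  then show ?thesis
    using assms by (auto simp: differentiable_def)
qed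

lemma C_k_Suc_has_derivative:
  assumes "C_k (Suc k) f"
  shows "(f has_derivative frechet_derivative f (at x)) (at x)"
  using assms frechet_derivative_works by auto

lemma C_k_SucD: "C_k (Suc k) f \<Longrightarrow> C_k k f"
proof (induction k arbitrary: f)
  case 0
  then show ?case
    by (simp add: continuous_on_eq_continuous_at differentiable_imp_continuous_within)
next
  case (Suc k)
  from Suc.prems have "\<And>x. f differentiable (at x)"
    and "\<And>b. b \<in> Basis \<Longrightarrow> C_k (Suc k) (\<lambda>x. frechet_derivative f (at x) b)"
    unfolding C_k.simps(2)[of "Suc k"] by blast+
  then show ?case
    unfolding C_k.simps(2)[of k f] using Suc.IH by blast
qed

lemma smooth_imp_C_k: "smooth f \<Longrightarrow> C_k k f"
  by (simp add: smooth_def)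

lemma smooth_has_derivative:
  "smooth f \<Longrightarrow> (f has_derivative frechet_derivative f (at x)) (at x)"
  using C_k_Suc_has_derivative smooth_imp_C_k by blast

lemma smooth_continuous: "smooth f \<Longrightarrow> continuous_on UNIV f"
  using smooth_imp_C_k[of f 0] by simp

lemma smooth_directional_derivative:
  "smooth f \<Longrightarrow> b \<in> Basis \<Longrightarrow> smooth (\<lambda>x. frechet_derivative f (at x) b)"
  by (metis C_k.simps(2) smooth_def)

lemma C_k_const: "C_k k (\<lambda>x. c)"
proof (induction k arbitrary: c)
  case (Suc k)
  show ?case
    by (rule C_k_SucI[where D = "\<lambda>x b. 0"]) (auto intro: Suc)
qed simp

lemma C_k_add: "C_k k f \<Longrightarrow> C_k k g \<Longrightarrow> C_k k (\<lambda>x. f x + g x)"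
proof (induction k arbitrary: f g)
  case 0
  then show ?case by (simp add: continuous_on_add)
next
  case (Suc k)
  show ?case
    by (rule C_k_SucI[OF has_derivative_add[OF Suc.prems[THEN C_k_Suc_has_derivative]]])
      (use Suc in auto)
qed

lemma C_k_mult:
  fixes f g :: "'a::euclidean_space \<Rightarrow> 'b::real_normed_algebra"
  shows "C_k k f \<Longrightarrow> C_k k g \<Longrightarrow> C_k k (\<lambda>x. f x * g x)"
proof (induction k arbitrary: f g)
  case 0
  then show ?case by (simp add: continuous_on_mult)
next
  case (Suc k)
  show ?case
  proof (rule C_k_SucI[OF has_derivative_mult[OF Suc.prems[THEN C_k_Suc_has_derivative]]])
    fix b :: 'a
    assume "b \<in> Basis"
    then have "C_k k (\<lambda>x. frechet_derivative f (at x) b)" "C_k k (\<lambda>x. frechet_derivative g (at x) b)"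
      using Suc.prems by simp_all
    then show "C_k k (\<lambda>x. f x * frechet_derivative g (at x) b + frechet_derivative f (at x) b * g x)"
      by (intro C_k_add Suc.IH Suc.prems[THEN C_k_SucD])
  qed
qed

lemma C_k_prod:
  fixes f :: "'c \<Rightarrow> 'a::euclidean_space \<Rightarrow> 'b::real_normed_field"
  assumes "\<And>i. i \<in> A \<Longrightarrow> C_k k (f i)"
  shows "C_k k (\<lambda>x. \<Prod>i\<in>A. f i x)"
  using assms by (induction A rule: infinite_finite_induct) (simp_all add: C_k_const C_k_mult)

lemma C_k_bounded_linear:
  assumes L: "bounded_linear L"
  shows "C_k k f \<Longrightarrow> C_k k (\<lambda>x. L (f x))"
proof (induction k arbitrary: f)
  case 0
  then show ?case
    using bounded_linear.continuous_on[OF L] by auto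
next
  case (Suc k)
  show ?case
    by (rule C_k_SucI[OF bounded_linear.has_derivative[OF L C_k_Suc_has_derivative[OF Suc.prems]]])
      (use Suc in auto)
qed

lemma C_k_ident: "C_k k (\<lambda>x::'a::euclidean_space. x)"
proof (cases k)
  case (Suc j)
  then show ?thesis
    using C_k_SucI[of "\<lambda>x. x" "\<lambda>x b. b"] by (auto intro: C_k_const has_derivative_ident)
qed simp

text \<open>The chain rule replaces \<open>f\<close> by its derivative, which need not resemble \<open>f\<close>; the induction
  closes because that derivative lies in the same family \<open>F\<close>.\<close>

lemma C_k_comp_derivative_closed:
  fixes F :: "(real \<Rightarrow> real) set" and q :: "'a::euclidean_space \<Rightarrow> real"
  assumes closed: "\<And>f. f \<in> F \<Longrightarrow> \<exists>f'\<in>F. \<forall>t. (f has_real_derivative f' t) (at t)"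
    and q: "smooth q" and "f \<in> F"
  shows "C_k k (\<lambda>x. f (q x))"
  using \<open>f \<in> F\<close>
proof (induction k arbitrary: f)
  case 0
  obtain f' where "\<And>t. (f has_real_derivative f' t) (at t)"
    using closed 0 by blast
  then have "continuous_on UNIV f"
    by (meson DERIV_isCont continuous_at_imp_continuous_on)
  then show ?case
    using continuous_on_compose2[OF _ smooth_continuous[OF q]] by auto
next
  case (Suc k)
  obtain f' where f': "f' \<in> F" "\<And>t. (f has_real_derivative f' t) (at t)"
    using closed Suc.prems by blast
  have "((\<lambda>x. f (q x)) has_derivative (\<lambda>b. f' (q x) * frechet_derivative q (at x) b)) (at x)" for x
    using has_derivative_compose[OF smooth_has_derivative[OF q] f'(2)[unfolded has_field_derivative_def]] .
  then show ?case
    by (rule C_k_SucI)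
      (intro C_k_mult Suc.IH f' smooth_imp_C_k smooth_directional_derivative[OF q])
qed

section \<open>Smooth bumps on boxes\<close>

text \<open>The functions \<open>P(1/t) exp(-1/t)\<close>, extended by \<open>0\<close> to \<open>t \<le> 0\<close>. The polynomial factor is there
  to make the family closed under differentiation; the function of interest is \<open>flat 1\<close>.\<close>

definition flat :: "real poly \<Rightarrow> real \<Rightarrow> real" where
  "flat P t = (if t > 0 then poly P (1 / t) * exp (- (1 / t)) else 0)"

lemma poly_exp_tendsto_0: "((\<lambda>s. poly P s * exp (- s)) \<longlongrightarrow> (0::real)) at_top"
proof -
  have "((\<lambda>s. \<Sum>i\<le>degree P. coeff P i * (s ^ i / exp s)) \<longlongrightarrow> (\<Sum>i\<le>degree P. coeff P i * 0)) at_top"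
    by (intro tendsto_intros tendsto_power_div_exp_0)
  then show ?thesis
    by (simp add: poly_altdef sum_distrib_right exp_minus divide_inverse mult.assoc)
qed

lemma flat_tendsto_0: "(flat P \<longlongrightarrow> 0) (at 0)"
proof -
  have "((\<lambda>t. poly P (1 / t) * exp (- (1 / t))) \<longlongrightarrow> 0) (at_right (0::real))"
    using filterlim_compose[OF poly_exp_tendsto_0 filterlim_inverse_at_top_right]
    by (simp add: inverse_eq_divide)
  then have "(flat P \<longlongrightarrow> 0) (at_right 0)"
    by (rule Lim_transform_eventually) (auto simp: flat_def eventually_at_right_less eventually_at_filter)
  moreover have "(flat P \<longlongrightarrow> 0) (at_left 0)"
    by (rule Lim_transform_eventually[OF tendsto_const]) (auto simp: flat_def eventually_at_filter)
  ultimately show ?thesis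
    using filterlim_at_split by blast
qed

text \<open>For \<open>t > 0\<close> the derivative of \<open>P(1/t) exp(-1/t)\<close> is \<open>(P - P')(1/t) exp(-1/t) / t\<^sup>2\<close>, and \<open>1/t\<^sup>2\<close>
  is the polynomial \<open>X\<^sup>2\<close> at \<open>1/t\<close>. At \<open>0\<close> the difference quotient is again a member of the family,
  hence tends to \<open>0\<close>.\<close>

lemma flat_has_derivative:
  "(flat P has_real_derivative flat ([:0, 0, 1:] * (P - pderiv P)) t) (at t)"
proof -
  consider "t > 0" | "t < 0" | "t = 0" by linarith
  then show ?thesis
  proof cases
    case 1
    have "((\<lambda>t. poly P (1 / t) * exp (- (1 / t))) has_real_derivative
        flat ([:0, 0, 1:] * (P - pderiv P)) t) (at t)"
      using 1 by (auto intro!: derivative_eq_intros poly_DERIV[THEN DERIV_chain2]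
          simp: flat_def field_simps power2_eq_square)
    then show ?thesis
      by (rule has_field_derivative_transform_within_open[where S = "{0<..}"])
        (use 1 in \<open>auto simp: flat_def\<close>)
  next
    case 2
    have "((\<lambda>t. 0) has_real_derivative flat ([:0, 0, 1:] * (P - pderiv P)) t) (at t)"
      using 2 by (simp add: flat_def)
    then show ?thesis
      by (rule has_field_derivative_transform_within_open[where S = "{..<0}"])
        (use 2 in \<open>auto simp: flat_def\<close>)
  next
    case 3
    have "(\<lambda>h. (flat P (0 + h) - flat P 0) / h) = flat (pCons 0 P)"
      by (auto simp: flat_def fun_eq_iff)
    then show ?thesis
      using flat_tendsto_0[of "pCons 0 P"] 3 by (simp add: DERIV_def flat_def)
  qed
qed

lemma smooth_flat_comp: "smooth q \<Longrightarrow> smooth (\<lambda>x. flat P (q x))"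
  unfolding smooth_def[of "\<lambda>x. flat P (q x)"]
  using C_k_comp_derivative_closed[of "range flat"] flat_has_derivative by blast

text \<open>As \<open>s\<close> grows, each factor \<open>exp(-1/(s t))\<close> with \<open>t > 0\<close> tends to \<open>1\<close>, so that these functions,
  bounded by \<open>1\<close>, converge to the indicator of the box.\<close>

definition box_bump :: "'a::euclidean_space \<Rightarrow> 'a \<Rightarrow> real \<Rightarrow> 'a \<Rightarrow> real" where
  "box_bump a b s x = (\<Prod>i\<in>Basis. flat 1 (s * (x \<bullet> i - a \<bullet> i)) * flat 1 (s * (b \<bullet> i - x \<bullet> i)))"

lemma smooth_box_bump: "smooth (\<lambda>x. box_bump a b s x)"
proof -
  have "smooth (\<lambda>x. s * (x \<bullet> i - a \<bullet> i))" "smooth (\<lambda>x. s * (b \<bullet> i - x \<bullet> i))" for i :: 'a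
  proof -
    have "C_k k (\<lambda>x. s * (x \<bullet> i) + (- s * (a \<bullet> i)))" "C_k k (\<lambda>x. (- s) * (x \<bullet> i) + s * (b \<bullet> i))" for k
      by (intro C_k_add C_k_const C_k_mult C_k_bounded_linear[OF bounded_linear_inner_left] C_k_ident)+
    then show "smooth (\<lambda>x. s * (x \<bullet> i - a \<bullet> i))" "smooth (\<lambda>x. s * (b \<bullet> i - x \<bullet> i))"
      by (simp_all add: smooth_def algebra_simps)
  qed
  then show ?thesis
    unfolding smooth_def[of "\<lambda>x. box_bump a b s x"]
    unfolding box_bump_def
    by (intro allI C_k_prod C_k_mult smooth_imp_C_k smooth_flat_comp)
qed

lemma flat_1_bounds: "0 \<le> flat 1 t" "flat 1 t \<le> 1"
  by (auto simp: flat_def)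

lemma flat_1_eq_0_iff: "flat 1 t = 0 \<longleftrightarrow> t \<le> 0"
  by (auto simp: flat_def)

lemma box_bump_bounds: "0 \<le> box_bump a b s x" "box_bump a b s x \<le> 1"
  unfolding box_bump_def
  by (auto intro!: prod_nonneg prod_le_1 mult_nonneg_nonneg mult_le_one flat_1_bounds)

lemma box_bump_eq_0_iff: "s > 0 \<Longrightarrow> box_bump a b s x = 0 \<longleftrightarrow> x \<notin> box a b"
  by (auto simp: box_bump_def flat_1_eq_0_iff mem_box mult_le_0_iff not_less)

lemma box_bump_tendsto_indicator:
  "(\<lambda>n. box_bump a b (real (Suc n)) x) \<longlonglongrightarrow> indicator (box a b) x"
proof (cases "x \<in> box a b")
  case True
  have *: "(\<lambda>n. flat 1 (real (Suc n) * t)) \<longlonglongrightarrow> 1" if "t > 0" for t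
  proof -
    have "(\<lambda>n. exp (- ((1 / t) * inverse (real (Suc n))))) \<longlonglongrightarrow> exp (- ((1 / t) * 0))"
      by (intro tendsto_intros LIMSEQ_inverse_real_of_nat)
    moreover have "flat 1 (real (Suc n) * t) = exp (- ((1 / t) * inverse (real (Suc n))))" for n
    proof -
      have "real (Suc n) * t > 0"
        using that by simp
      then show ?thesis
        by (simp only: flat_def if_True poly_1 inverse_eq_divide) (simp add: mult.commute)
    qed
    ultimately show ?thesis
      by simp
  qed
  have "(\<lambda>n. box_bump a b (real (Suc n)) x) \<longlonglongrightarrow> (\<Prod>i\<in>(Basis::'a set). 1 * 1)"
    unfolding box_bump_def
    by (intro tendsto_prod tendsto_mult *) (use True in \<open>auto simp: mem_box\<close>)
  then show ?thesis
    using True by simp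
next
  case False
  then show ?thesis
    using box_bump_eq_0_iff[of _ a b x] by simp
qed

lemma test_function_box_bump:
  fixes a b :: "real^'n"
  assumes "cbox a b \<subseteq> \<Omega>" "s > 0"
  shows "test_function \<Omega> (\<lambda>x. of_real (box_bump a b s x))"
proof -
  have *: "{x. complex_of_real (box_bump a b s x) \<noteq> 0} = box a b"
    using box_bump_eq_0_iff[OF \<open>s > 0\<close>, of a b] by auto
  have "smooth (\<lambda>x. complex_of_real (box_bump a b s x))"
    using smooth_box_bump C_k_bounded_linear[OF bounded_linear_of_real] unfolding smooth_def by blast
  moreover have "closure (box a b) \<subseteq> cbox a b"
    by (intro closure_minimal box_subset_cbox closed_cbox)
  ultimately show ?thesis
    using assms unfolding test_function_def * by (auto simp: compact_closure)
qed

lemma test_function_cmult: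
  assumes "test_function \<Omega> \<phi>"
  shows "test_function \<Omega> (\<lambda>x. c * \<phi> x)"
proof -
  have "closure {x. c * \<phi> x \<noteq> 0} \<subseteq> closure {x. \<phi> x \<noteq> 0}"
    by (rule closure_mono) auto
  moreover have "C_k k (\<lambda>x. c * \<phi> x)" for k
    using assms by (intro C_k_mult C_k_const) (simp add: test_function_def smooth_def)
  ultimately show ?thesis
    using assms closed_Int_compact[of "closure {x. c * \<phi> x \<noteq> 0}" "closure {x. \<phi> x \<noteq> 0}"]
    by (auto simp: test_function_def smooth_def Int_absorb2)
qed

lemma grad_cmult:
  assumes "smooth \<phi>"
  shows "grad (\<lambda>x. c * \<phi> x) x = (\<chi> l. c * grad \<phi> x $ l)"
proof -
  have "((\<lambda>x. c * \<phi> x) has_derivative (\<lambda>b. c * frechet_derivative \<phi> (at x) b)) (at x)"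
    using smooth_has_derivative[OF assms] by (rule has_derivative_mult_right)
  then show ?thesis
    by (simp add: grad_def frechet_derivative_at[symmetric])
qed

section \<open>Integrals of directional derivatives, and functions with vanishing box integrals\<close>

lemma integrable_continuous_compact_support:
  fixes f :: "'a::euclidean_space \<Rightarrow> 'b::{banach, second_countable_topology}"
  assumes "continuous_on UNIV f" "compact K" "\<And>x. x \<notin> K \<Longrightarrow> f x = 0"
  shows "integrable lborel f"
proof -
  have "integrable lborel (\<lambda>x. indicator K x *\<^sub>R f x)"
    using assms by (intro borel_integrable_compact) (auto intro: continuous_on_subset)
  moreover have "(\<lambda>x. indicator K x *\<^sub>R f x) = f"
    using assms(3) by (auto simp: fun_eq_iff indicator_def)
  ultimately show ?thesis
    by simp
qed

lemma integral_lborel_translate: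
  fixes f :: "'a::euclidean_space \<Rightarrow> 'b::{banach, second_countable_topology}"
  assumes "f \<in> borel_measurable borel"
  shows "(LINT x|lborel. f (x + c)) = (LINT x|lborel. f x)"
proof -
  have "(LINT x|lborel. f x) = (LINT x|distr lborel borel ((+) c). f x)"
    by (simp add: lborel_distr_plus)
  also have "\<dots> = (LINT x|lborel. f (c + x))"
    using assms by (intro integral_distr) simp_all
  finally show ?thesis
    by (simp add: add.commute)
qed

lemma norm_increment_le:
  fixes F :: "'a::euclidean_space \<Rightarrow> complex"
  assumes der: "\<And>x. (F has_derivative D x) (at x)" and "0 \<le> h"
    and B: "\<And>t. 0 \<le> t \<Longrightarrow> t \<le> h \<Longrightarrow> norm (D (x + t *\<^sub>R e) e) \<le> B"
  shows "norm (F (x + h *\<^sub>R e) - F x) \<le> B * h"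
proof -
  define g where "g t = F (x + t *\<^sub>R e)" for t :: real
  have g': "(g has_derivative (\<lambda>s. s *\<^sub>R D (x + t *\<^sub>R e) e)) (at t within {0..h})" for t
  proof -
    have "((\<lambda>t. x + t *\<^sub>R e) has_derivative (\<lambda>s. s *\<^sub>R e)) (at t within {0..h})"
      by (auto intro!: derivative_eq_intros)
    from has_derivative_compose[OF this der]
    show ?thesis
      using linear_scale[OF has_derivative_linear[OF der]] unfolding g_def by simp
  qed
  have "norm (g h - g 0) \<le> B * norm (h - 0)"
  proof (rule differentiable_bound[OF convex_real_interval(5) g'])
    fix t assume "t \<in> {0..h}"
    then show "onorm (\<lambda>s. s *\<^sub>R D (x + t *\<^sub>R e) e) \<le> B"
      using B[of t] by (intro onorm_le) (simp add: mult.commute[of B] mult_left_mono)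
  qed (use \<open>0 \<le> h\<close> in auto)
  then show ?thesis
    using \<open>0 \<le> h\<close> by (simp add: g_def)
qed

lemma has_vector_derivative_quotient_tendsto:
  fixes F :: "'a::real_normed_vector \<Rightarrow> 'b::real_normed_vector"
  assumes "((\<lambda>t. F (x + t *\<^sub>R e)) has_vector_derivative v) (at 0)"
  shows "((\<lambda>t. (1 / t) *\<^sub>R (F (x + t *\<^sub>R e) - F x)) \<longlongrightarrow> v) (at 0)"
proof -
  have "((\<lambda>t. norm (F (x + t *\<^sub>R e) - F x - t *\<^sub>R v) / \<bar>t\<bar>) \<longlongrightarrow> 0) (at 0)"
    using assms by (simp add: has_vector_derivative_def has_derivative_at)
  moreover have "norm (F (x + t *\<^sub>R e) - F x - t *\<^sub>R v) / \<bar>t\<bar> = norm ((1 / t) *\<^sub>R (F (x + t *\<^sub>R e) - F x) - v)"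
    if "t \<noteq> 0" for t
  proof -
    have "(1 / t) *\<^sub>R (F (x + t *\<^sub>R e) - F x) - v = (1 / t) *\<^sub>R (F (x + t *\<^sub>R e) - F x - t *\<^sub>R v)"
      using that by (simp add: scaleR_diff_right)
    then show ?thesis
      by simp
  qed
  ultimately have "((\<lambda>t. norm ((1 / t) *\<^sub>R (F (x + t *\<^sub>R e) - F x) - v)) \<longlongrightarrow> 0) (at 0)"
    by (subst (asm) LIM_cong[OF refl _ refl]) auto
  then show ?thesis
    by (simp add: tendsto_norm_zero_iff LIM_zero_iff)
qed

text \<open>The integral of \<open>F(x + h e) - F(x)\<close> vanishes by translation invariance, for every \<open>h\<close>. The
  difference quotients are bounded, by the mean value inequality, and vanish outside a common ball,
  so dominated convergence passes to the limit \<open>h \<rightarrow> 0\<close>.\<close>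

lemma integral_directional_derivative_eq_0:
  fixes F :: "'a::euclidean_space \<Rightarrow> complex"
  assumes der: "\<And>x. (F has_derivative D x) (at x)"
    and cont: "continuous_on UNIV (\<lambda>x. D x e)"
    and K: "compact K" "\<And>x. x \<notin> K \<Longrightarrow> F x = 0"
  shows "(LINT x|lborel. D x e) = 0"
proof -
  \<comment> \<open>Step lengths are at most \<open>1\<close>: the quotients live in the ball of radius \<open>R + |e|\<close>, and their
      segments in the ball of radius \<open>R + 2|e|\<close>, on which the derivative is bounded by \<open>B\<close>.\<close>
  obtain R where R: "K \<subseteq> cball 0 R"
    using compact_imp_bounded[OF K(1)] by (auto simp: bounded_iff subset_iff)
  have "bounded ((\<lambda>x. D x e) ` cball 0 (R + 2 * norm e))"
    by (intro compact_imp_bounded compact_continuous_image compact_cball continuous_on_subset[OF cont]) simp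
  then obtain B where B: "\<And>x. x \<in> cball 0 (R + 2 * norm e) \<Longrightarrow> norm (D x e) \<le> B"
    unfolding bounded_iff by blast
  define h where "h n = inverse (real (Suc n))" for n
  have h: "0 < h n" "h n \<le> 1" for n
    by (auto simp: h_def field_simps)
  define q where "q n x = (1 / h n) *\<^sub>R (F (x + h n *\<^sub>R e) - F x)" for n x
  have contF: "continuous_on UNIV F"
    using der by (meson continuous_at_imp_continuous_on has_derivative_continuous)
  have intF: "integrable lborel F"
    by (rule integrable_continuous_compact_support[OF contF K])
  have intF_shift: "integrable lborel (\<lambda>x. F (x + c))" for c
  proof (rule integrable_continuous_compact_support)
    show "compact ((\<lambda>x. x - c) ` K)"
      by (intro compact_continuous_image K continuous_intros)
    show "F (x + c) = 0" if "x \<notin> (\<lambda>x. x - c) ` K" for x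
      using that by (intro K(2)) (auto simp: image_iff)
    show "continuous_on UNIV (\<lambda>x. F (x + c))"
      by (rule continuous_on_compose2[OF contF]) (auto intro!: continuous_intros)
  qed
  have "(LINT x|lborel. q n x) = 0" for n
    unfolding q_def using intF intF_shift integral_lborel_translate[of F] contF
    by (simp add: Bochner_Integration.integral_diff borel_measurable_continuous_onI)
  moreover have "(\<lambda>n. LINT x|lborel. q n x) \<longlonglongrightarrow> (LINT x|lborel. D x e)"
  proof (rule integral_dominated_convergence)
    show "(\<lambda>x. D x e) \<in> borel_measurable lborel"
      using cont by (simp add: borel_measurable_continuous_onI)
    have "continuous_on UNIV (q n)" for n
      unfolding q_def by (intro continuous_intros continuous_on_compose2[OF contF]) auto
    then show "q n \<in> borel_measurable lborel" for n
      by (simp add: borel_measurable_continuous_onI)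
    show "integrable lborel (\<lambda>x. B * indicator (cball 0 (R + norm e)) x)"
      by (intro integrable_mult_right integrable_real_indicator) (use emeasure_bounded_finite[OF bounded_cball] in auto)
    show "AE x in lborel. (\<lambda>n. q n x) \<longlonglongrightarrow> D x e"
    proof (rule AE_I2)
      fix x
      have "((\<lambda>t. x + t *\<^sub>R e) has_derivative (\<lambda>s. s *\<^sub>R e)) (at 0)"
        by (auto intro!: derivative_eq_intros)
      from has_derivative_compose[OF this, of F] der[of x]
      have "((\<lambda>t. F (x + t *\<^sub>R e)) has_derivative (\<lambda>s. D x (s *\<^sub>R e))) (at 0)"
        by simp
      then have "((\<lambda>t. F (x + t *\<^sub>R e)) has_vector_derivative D x e) (at 0)"
        using linear_scale[OF has_derivative_linear[OF der]]
        by (simp add: has_vector_derivative_def)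
      then have "((\<lambda>t. (1 / t) *\<^sub>R (F (x + t *\<^sub>R e) - F x)) \<longlongrightarrow> D x e) (at 0)"
        by (rule has_vector_derivative_quotient_tendsto)
      moreover have "filterlim h (at 0) sequentially"
        unfolding h_def using LIMSEQ_inverse_real_of_nat by (auto simp: filterlim_at)
      ultimately show "(\<lambda>n. q n x) \<longlonglongrightarrow> D x e"
        unfolding q_def by (rule filterlim_compose)
    qed
    show "AE x in lborel. norm (q n x) \<le> B * indicator (cball 0 (R + norm e)) x" for n
    proof (rule AE_I2)
      fix x
      have he: "norm (t *\<^sub>R e) \<le> norm e" if "0 \<le> t" "t \<le> h n" for t
        using that h[of n] by (simp add: mult_left_le_one_le)
      show "norm (q n x) \<le> B * indicator (cball 0 (R + norm e)) x"
      proof (cases "x \<in> cball 0 (R + norm e)")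
        case True
        have "norm (F (x + h n *\<^sub>R e) - F x) \<le> B * h n"
        proof (rule norm_increment_le[OF der])
          fix t assume "0 \<le> t" "t \<le> h n"
          then show "norm (D (x + t *\<^sub>R e) e) \<le> B"
            using True he[of t] norm_triangle_ineq[of x "t *\<^sub>R e"] by (intro B) simp
        qed (use h[of n] in simp)
        then show ?thesis
          using True h[of n] by (simp add: q_def norm_scaleR divide_le_eq del: scaleR_diff_right)
      next
        case False
        then have "x \<notin> K" "x + h n *\<^sub>R e \<notin> K"
          using R he[of "h n"] h[of n] norm_triangle_ineq4[of "x + h n *\<^sub>R e" "h n *\<^sub>R e"] norm_ge_zero[of e]
          by (auto simp: subset_iff simp del: norm_ge_zero)
        then show ?thesis
          using False K(2) by (simp add: q_def)
      qed
    qed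
  qed
  ultimately show ?thesis
    by (simp add: LIMSEQ_const_iff)
qed


lemma sigma_finite_lebesgue: "sigma_finite_measure (lebesgue :: 'a::euclidean_space measure)"
proof
  obtain A :: "'a set set" where "countable A" "A \<subseteq> sets lborel" "\<Union>A = space lborel"
    "\<forall>a\<in>A. emeasure lborel a \<noteq> \<infinity>"
    using lborel.sigma_finite_countable by blast
  then show "\<exists>A::'a set set. countable A \<and> A \<subseteq> sets lebesgue \<and> \<Union>A = space lebesgue \<and> (\<forall>a\<in>A. emeasure lebesgue a \<noteq> \<infinity>)"
    by (intro exI[of _ A]) auto
qed

text \<open>Boxes are stable under intersection and generate the Borel sets, so this is a Dynkin argument.
  The hypothesis on the integral over the whole space provides the step to complements.\<close>

lemma set_integral_borel_eq_0:
  fixes h :: "'a::euclidean_space \<Rightarrow> complex"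
  assumes h: "integrable lebesgue h" "(LINT x|lebesgue. h x) = 0"
    and box: "\<And>a b. (LINT x:box a b|lebesgue. h x) = 0"
    and "A \<in> sets borel"
  shows "(LINT x:A|lebesgue. h x) = 0"
proof -
  have int: "set_integrable lebesgue B h" if "B \<in> sets lebesgue" for B
    using that h(1) by (simp add: set_integrable_def integrable_mult_indicator)
  have "Int_stable (range (\<lambda>(a, b). box a b :: 'a set))"
    by (auto simp: Int_stable_def box_Int_box)
  moreover have "range (\<lambda>(a, b). box a b :: 'a set) \<subseteq> Pow UNIV"
    by auto
  moreover have "A \<in> sigma_sets UNIV (range (\<lambda>(a, b). box a b))"
    using \<open>A \<in> sets borel\<close> unfolding borel_eq_box by simp
  ultimately show ?thesis
  proof (induction rule: sigma_sets_induct_disjoint)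
    case (basic A)
    then show ?case
      using box by auto
  next
    case empty
    then show ?case
      by (simp add: set_lebesgue_integral_def)
  next
    case (compl A)
    then have A: "A \<in> sets lebesgue"
      by (metis borel_eq_box sets_completionI_sets sets_lborel sets_measure_of subset_UNIV Pow_UNIV)
    have "(LINT x:UNIV|lebesgue. h x) = (LINT x:UNIV - A|lebesgue. h x) + (LINT x:A|lebesgue. h x)"
      using A sets.compl_sets[OF A]
      by (subst set_integral_Un[symmetric]) (auto intro!: int simp del: Diff_UNIV simp: Un_absorb1)
    then show ?case
      using compl h(2) by (simp add: set_lebesgue_integral_def)
  next
    case (union F)
    then have F: "F i \<in> sets lebesgue" for i
      by (metis borel_eq_box sets_completionI_sets sets_lborel sets_measure_of subset_UNIV Pow_UNIV range_subsetD)
    have "(LINT x:(\<Union>i. F i)|lebesgue. h x) = (\<Sum>i. LINT x:F i|lebesgue. h x)"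
      using union(1) F by (intro lebesgue_integral_countable_add int sets.countable_UN) (auto simp: disjoint_family_on_def)
    then show ?case
      using union by simp
  qed
qed

text \<open>A Lebesgue measurable set differs from a Borel set by a null set, so all integrals of \<open>h\<close> over
  measurable sets vanish.\<close>

lemma AE_eq_0_if_box_integrals_eq_0:
  fixes h :: "'a::euclidean_space \<Rightarrow> complex"
  assumes h: "integrable lebesgue h" "(LINT x|lebesgue. h x) = 0"
    and box: "\<And>a b. (LINT x:box a b|lebesgue. h x) = 0"
  shows "AE x in lebesgue. h x = 0"
proof (rule sigma_finite_measure.density_zero[OF sigma_finite_lebesgue h(1)])
  fix A :: "'a set"
  assume A: "A \<in> sets lebesgue"
  then obtain S N N' where N: "A = S \<union> N" "N \<subseteq> N'" "N' \<in> null_sets lborel" and S: "S \<in> sets lborel"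
    by (rule sets_completionE)
  have "(LINT x:A|lebesgue. h x) = (LINT x:S|lebesgue. h x)"
  proof (rule set_integral_cong_set)
    show "set_borel_measurable lebesgue S h" "set_borel_measurable lebesgue A h"
      using A S h(1) by (auto simp: set_borel_measurable_def intro!: borel_measurable_scaleR borel_measurable_indicator)
    have "AE x in lebesgue. x \<notin> N'"
      using N by (intro AE_not_in null_sets_completionI)
    then show "AE x in lebesgue. (x \<in> S) = (x \<in> A)"
      by (rule AE_mp) (use N in auto)
  qed
  then show "(LINT x:A|lebesgue. h x) = 0"
    using set_integral_borel_eq_0[OF h box] S by simp
qed

section \<open>Uniqueness of weak gradients\<close>

lemma lebesgue_on_open_zero_outside:
  fixes f :: "'a::euclidean_space \<Rightarrow> 'b::{banach, second_countable_topology}"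
  assumes "open \<Omega>" "f \<in> borel_measurable borel" "\<And>x. x \<notin> \<Omega> \<Longrightarrow> f x = 0"
  shows "(LINT x|lebesgue_on \<Omega>. f x) = (LINT x|lborel. f x)"
    and "integrable (lebesgue_on \<Omega>) f \<longleftrightarrow> integrable lborel f"
proof -
  have "(\<lambda>x. indicator \<Omega> x *\<^sub>R f x) = f"
    using assms(3) by (auto simp: fun_eq_iff indicator_def)
  moreover have "\<Omega> \<in> sets lebesgue"
    using \<open>open \<Omega>\<close> by simp
  ultimately show "(LINT x|lebesgue_on \<Omega>. f x) = (LINT x|lborel. f x)"
    and "integrable (lebesgue_on \<Omega>) f \<longleftrightarrow> integrable lborel f"
    using assms(2) by (simp_all add: integral_restrict_space integrable_restrict_space
        integral_completion integrable_completion)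
qed

lemma frechet_derivative_outside_support:
  assumes "x \<notin> closure {y. \<phi> y \<noteq> 0}"
  shows "frechet_derivative \<phi> (at x) = (\<lambda>_. 0)"
proof -
  have "((\<lambda>_. 0) has_derivative (\<lambda>_. 0)) (at x)"
    by simp
  then have "(\<phi> has_derivative (\<lambda>_. 0)) (at x)"
    by (rule has_derivative_transform_within_open[where s = "- closure {y. \<phi> y \<noteq> 0}"])
      (use assms closure_subset[of "{y. \<phi> y \<noteq> 0}"] in auto)
  then show ?thesis
    by (simp add: frechet_derivative_at[symmetric])
qed

lemma zero_outside_support: "x \<notin> closure {y. \<phi> y \<noteq> 0} \<Longrightarrow> \<phi> x = 0"
  using closure_subset[of "{y. \<phi> y \<noteq> 0}"] by auto

lemma grad_outside_support: "x \<notin> closure {y. \<phi> y \<noteq> 0} \<Longrightarrow> grad \<phi> x = 0"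
  by (simp add: grad_def frechet_derivative_outside_support vec_eq_iff)

text \<open>The product \<open>\<phi> \<psi>\<close> inherits compact support from \<open>\<psi>\<close>, so the integral of its derivative vanishes.\<close>

lemma integral_by_parts:
  fixes \<phi> \<psi> :: "'a::euclidean_space \<Rightarrow> complex"
  assumes "smooth \<phi>" "smooth \<psi>" "compact (closure {x. \<psi> x \<noteq> 0})" "b \<in> Basis"
  shows "(LINT x|lborel. \<phi> x * frechet_derivative \<psi> (at x) b)
    = - (LINT x|lborel. frechet_derivative \<phi> (at x) b * \<psi> x)"
proof -
  define D where "D x h = \<phi> x * frechet_derivative \<psi> (at x) h + frechet_derivative \<phi> (at x) h * \<psi> x" for x h
  have cont: "continuous_on UNIV \<phi>" "continuous_on UNIV \<psi>"
    "continuous_on UNIV (\<lambda>x. frechet_derivative \<phi> (at x) b)"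
    "continuous_on UNIV (\<lambda>x. frechet_derivative \<psi> (at x) b)"
    using assms smooth_continuous smooth_directional_derivative by blast+
  have "(LINT x|lborel. D x b) = 0"
  proof (rule integral_directional_derivative_eq_0[where K = "closure {x. \<psi> x \<noteq> 0}"])
    show "((\<lambda>x. \<phi> x * \<psi> x) has_derivative D x) (at x)" for x
      unfolding D_def by (intro has_derivative_mult smooth_has_derivative assms)
    show "continuous_on UNIV (\<lambda>x. D x b)"
      unfolding D_def by (intro continuous_on_add continuous_on_mult cont)
    show "\<phi> x * \<psi> x = 0" if "x \<notin> closure {x. \<psi> x \<noteq> 0}" for x
      using zero_outside_support[OF that] by simp
  qed (rule assms(3))
  moreover have "integrable lborel (\<lambda>x. \<phi> x * frechet_derivative \<psi> (at x) b)"
    by (rule integrable_continuous_compact_support[OF _ assms(3)])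
      (simp_all add: continuous_on_mult cont frechet_derivative_outside_support)
  moreover have "integrable lborel (\<lambda>x. frechet_derivative \<phi> (at x) b * \<psi> x)"
  proof (rule integrable_continuous_compact_support[OF _ assms(3)])
    show "frechet_derivative \<phi> (at x) b * \<psi> x = 0" if "x \<notin> closure {x. \<psi> x \<noteq> 0}" for x
      using zero_outside_support[OF that] by simp
  qed (intro continuous_on_mult cont)
  ultimately show ?thesis
    by (simp add: D_def eq_neg_iff_add_eq_0)
qed

lemma L2_on_continuous_compact_support:
  fixes f :: "real^'n \<Rightarrow> 'b::euclidean_space"
  assumes "open \<Omega>" "continuous_on UNIV f" "compact K" "K \<subseteq> \<Omega>" "\<And>x. x \<notin> K \<Longrightarrow> f x = 0"
  shows "L2_on \<Omega> f"
proof -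
  have "f \<in> borel_measurable (lebesgue_on \<Omega>)"
    using assms by (intro continuous_imp_measurable_on_sets_lebesgue continuous_on_subset[OF assms(2)]) auto
  moreover have *: "continuous_on UNIV (\<lambda>x. (norm (f x))\<^sup>2)"
    using assms(2) by (intro continuous_intros)
  have "integrable lborel (\<lambda>x. (norm (f x))\<^sup>2)"
    using assms by (intro integrable_continuous_compact_support[OF *]) auto
  then have "integrable (lebesgue_on \<Omega>) (\<lambda>x. (norm (f x))\<^sup>2)"
    using assms * by (subst lebesgue_on_open_zero_outside) (auto intro!: borel_measurable_continuous_onI)
  ultimately show ?thesis
    by (simp add: L2_on_def)
qed

lemma continuous_grad: "smooth \<phi> \<Longrightarrow> continuous_on UNIV (grad \<phi>)"
  unfolding grad_def[abs_def]
  by (intro continuous_on_vec_lambda smooth_continuous smooth_directional_derivative) auto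

lemma L2_on_test_function:
  assumes "open \<Omega>" "test_function \<Omega> \<phi>"
  shows "L2_on \<Omega> \<phi>" "L2_on \<Omega> (grad \<phi>)"
proof -
  have K: "compact (closure {x. \<phi> x \<noteq> 0})" "closure {x. \<phi> x \<noteq> 0} \<subseteq> \<Omega>" and "smooth \<phi>"
    using assms(2) by (simp_all add: test_function_def)
  show "L2_on \<Omega> \<phi>"
    by (rule L2_on_continuous_compact_support[OF assms(1) smooth_continuous[OF \<open>smooth \<phi>\<close>] K])
      (rule zero_outside_support)
  show "L2_on \<Omega> (grad \<phi>)"
    by (rule L2_on_continuous_compact_support[OF assms(1) continuous_grad[OF \<open>smooth \<phi>\<close>] K])
      (rule grad_outside_support)
qed

lemma is_weak_grad_grad:
  assumes "open \<Omega>" "test_function \<Omega> \<phi>"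
  shows "is_weak_grad \<Omega> \<phi> (grad \<phi>)"
  unfolding is_weak_grad_def
proof (intro conjI allI impI)
  show "L2_on \<Omega> (grad \<phi>)"
    using L2_on_test_function assms by blast
next
  fix \<psi> l
  assume \<psi>: "test_function \<Omega> \<psi>"
  have b: "axis l 1 \<in> (Basis :: (real^'a) set)"
    by simp
  have cont: "continuous_on UNIV \<phi>" "continuous_on UNIV \<psi>"
    "continuous_on UNIV (\<lambda>x. frechet_derivative \<phi> (at x) (axis l 1))"
    "continuous_on UNIV (\<lambda>x. frechet_derivative \<psi> (at x) (axis l 1))"
    using assms \<psi> smooth_continuous smooth_directional_derivative[OF _ b] by (auto simp: test_function_def)
  have "(LINT x|lebesgue_on \<Omega>. \<phi> x * grad \<psi> x $ l) = (LINT x|lborel. \<phi> x * frechet_derivative \<psi> (at x) (axis l 1))"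
    unfolding grad_def vec_lambda_beta using assms(1)
  proof (rule lebesgue_on_open_zero_outside)
    show "(\<lambda>x. \<phi> x * frechet_derivative \<psi> (at x) (axis l 1)) \<in> borel_measurable borel"
      by (intro borel_measurable_continuous_onI continuous_on_mult cont)
    show "\<phi> x * frechet_derivative \<psi> (at x) (axis l 1) = 0" if "x \<notin> \<Omega>" for x
      using that assms(2) zero_outside_support[of x \<phi>] by (auto simp: test_function_def)
  qed
  also have "\<dots> = - (LINT x|lborel. frechet_derivative \<phi> (at x) (axis l 1) * \<psi> x)"
    using assms \<psi> b by (intro integral_by_parts) (auto simp: test_function_def)
  also have "(LINT x|lborel. frechet_derivative \<phi> (at x) (axis l 1) * \<psi> x) = (LINT x|lebesgue_on \<Omega>. grad \<phi> x $ l * \<psi> x)"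
    unfolding grad_def vec_lambda_beta
  proof (rule lebesgue_on_open_zero_outside(1)[OF assms(1), symmetric])
    show "(\<lambda>x. frechet_derivative \<phi> (at x) (axis l 1) * \<psi> x) \<in> borel_measurable borel"
      by (intro borel_measurable_continuous_onI continuous_on_mult cont)
    show "frechet_derivative \<phi> (at x) (axis l 1) * \<psi> x = 0" if "x \<notin> \<Omega>" for x
      using that \<psi> zero_outside_support[of x \<psi>] by (auto simp: test_function_def)
  qed
  finally show "(LINT x|lebesgue_on \<Omega>. \<phi> x * grad \<psi> x $ l) = - (LINT x|lebesgue_on \<Omega>. grad \<phi> x $ l * \<psi> x)" .
qed

lemma L2_on_integrable_compact:
  fixes g :: "real^'n \<Rightarrow> 'b::euclidean_space"
  assumes "open \<Omega>" "L2_on \<Omega> g" "compact K"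
  shows "integrable (lebesgue_on \<Omega>) (\<lambda>x. indicator K x *\<^sub>R g x)"
proof (rule Bochner_Integration.integrable_bound)
  have K: "K \<in> sets borel"
    using assms(3) by (simp add: borel_compact)
  have KO: "K \<inter> \<Omega> \<in> sets lebesgue"
    using K assms(1) by (simp add: sets.Int)
  have "emeasure (lebesgue_on \<Omega>) (K \<inter> \<Omega>) < \<infinity>"
  proof -
    have "emeasure (lebesgue_on \<Omega>) (K \<inter> \<Omega>) = emeasure lebesgue (K \<inter> \<Omega>)"
      using assms(1) by (intro emeasure_restrict_space) auto
    also have "\<dots> = emeasure lborel (K \<inter> \<Omega>)"
      using K assms(1) by simp
    also have "\<dots> < \<infinity>"
      by (intro emeasure_bounded_finite bounded_Int disjI1 compact_imp_bounded assms(3))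
    finally show ?thesis .
  qed
  then have "integrable (lebesgue_on \<Omega>) (indicat_real (K \<inter> \<Omega>))"
    using KO assms(1) by (intro integrable_real_indicator) (auto simp: sets_restrict_space_iff)
  then show "integrable (lebesgue_on \<Omega>) (\<lambda>x. indicat_real (K \<inter> \<Omega>) x + (norm (g x))\<^sup>2)"
    using assms(2) unfolding L2_on_def by (intro Bochner_Integration.integrable_add) auto
  have "K \<inter> \<Omega> \<in> sets (lebesgue_on \<Omega>)"
    using KO assms(1) by (auto simp: sets_restrict_space_iff)
  moreover have "(\<lambda>x. indicator K x *\<^sub>R g x) \<in> borel_measurable (lebesgue_on \<Omega>) \<longleftrightarrow> (\<lambda>x. indicator (K \<inter> \<Omega>) x *\<^sub>R g x) \<in> borel_measurable (lebesgue_on \<Omega>)"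
    by (intro measurable_lebesgue_cong) (auto simp: indicator_def)
  ultimately show "(\<lambda>x. indicator K x *\<^sub>R g x) \<in> borel_measurable (lebesgue_on \<Omega>)"
    using assms(2) unfolding L2_on_def by (auto intro!: borel_measurable_scaleR borel_measurable_indicator)
  show "AE x in lebesgue_on \<Omega>. norm (indicator K x *\<^sub>R g x) \<le> norm (indicat_real (K \<inter> \<Omega>) x + (norm (g x))\<^sup>2)"
  proof (rule AE_I2)
    fix x assume "x \<in> space (lebesgue_on \<Omega>)"
    then have "x \<in> \<Omega>"
      by simp
    \<comment> \<open>This bound is why square integrability implies integrability on sets of finite measure.\<close>
    moreover have "norm (g x) \<le> 1 + (norm (g x))\<^sup>2"
    proof -
      have "0 \<le> (norm (g x) - 1)\<^sup>2"
        by simp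
      also have "\<dots> = 1 + (norm (g x))\<^sup>2 - 2 * norm (g x)"
        by (simp add: power2_eq_square algebra_simps)
      finally show ?thesis
        using norm_ge_zero[of "g x"] by linarith
    qed
    ultimately show "norm (indicator K x *\<^sub>R g x) \<le> norm (indicat_real (K \<inter> \<Omega>) x + (norm (g x))\<^sup>2)"
      by (auto simp: indicator_def)
  qed
qed

lemma integrable_test_mult:
  fixes h :: "real^'n \<Rightarrow> complex"
  assumes "test_function \<Omega> \<phi>"
    and h: "\<And>K. compact K \<Longrightarrow> integrable (lebesgue_on \<Omega>) (\<lambda>x. indicator K x *\<^sub>R h x)"
    and "open \<Omega>"
  shows "integrable (lebesgue_on \<Omega>) (\<lambda>x. h x * \<phi> x)"
proof -
  define K where "K = closure {x. \<phi> x \<noteq> 0}"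
  have K: "compact K"
    using assms(1) by (simp add: K_def test_function_def)
  have cont: "continuous_on UNIV \<phi>"
    using assms(1) by (simp add: test_function_def smooth_continuous)
  then have "bounded (\<phi> ` K)"
    by (intro compact_imp_bounded compact_continuous_image K continuous_on_subset[OF cont]) simp
  then obtain B where B: "\<And>x. x \<in> K \<Longrightarrow> norm (\<phi> x) \<le> B"
    unfolding bounded_iff by blast
  have *: "h x * \<phi> x = (indicator K x *\<^sub>R h x) * \<phi> x" for x
    using zero_outside_support[of x \<phi>] by (auto simp: K_def indicator_def)
  have "integrable (lebesgue_on \<Omega>) (\<lambda>x. (indicator K x *\<^sub>R h x) * \<phi> x)"
  proof (rule Bochner_Integration.integrable_bound)
    show "integrable (lebesgue_on \<Omega>) (\<lambda>x. B *\<^sub>R (indicator K x *\<^sub>R h x))"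
      by (intro integrable_scaleR_right h K)
    have "\<phi> \<in> borel_measurable (lebesgue_on \<Omega>)"
      using assms(3) by (intro continuous_imp_measurable_on_sets_lebesgue continuous_on_subset[OF cont]) auto
    then show "(\<lambda>x. (indicator K x *\<^sub>R h x) * \<phi> x) \<in> borel_measurable (lebesgue_on \<Omega>)"
      by (intro borel_measurable_times borel_measurable_integrable[OF h[OF K]])
    show "AE x in lebesgue_on \<Omega>. norm ((indicator K x *\<^sub>R h x) * \<phi> x) \<le> norm (B *\<^sub>R (indicator K x *\<^sub>R h x))"
    proof (rule AE_I2)
      fix x
      show "norm ((indicator K x *\<^sub>R h x) * \<phi> x) \<le> norm (B *\<^sub>R (indicator K x *\<^sub>R h x))"
        using B[of x] mult_left_mono[of "norm (\<phi> x)" "\<bar>B\<bar>" "norm (h x)"]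
        by (auto simp: indicator_def norm_mult mult.commute)
    qed
  qed
  then show ?thesis
    by (simp only: *[symmetric])
qed


text \<open>The fundamental lemma of the calculus of variations. On a box whose closure lies in \<open>\<Omega>\<close>, the
  integral of \<open>h\<close> over any smaller box is the limit of its integrals against smooth bumps, hence \<open>0\<close>;
  countably many such boxes cover \<open>\<Omega>\<close>.\<close>

lemma AE_eq_0_if_orthogonal_to_test_functions:
  fixes h :: "real^'n \<Rightarrow> complex"
  assumes "open \<Omega>"
    and h: "\<And>K. compact K \<Longrightarrow> integrable (lebesgue_on \<Omega>) (\<lambda>x. indicator K x *\<^sub>R h x)"
    and orth: "\<And>\<phi>. test_function \<Omega> \<phi> \<Longrightarrow> (LINT x|lebesgue_on \<Omega>. h x * \<phi> x) = 0"
  shows "AE x in lebesgue_on \<Omega>. h x = 0"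
proof -
  have \<Omega>: "\<Omega> \<inter> space lebesgue \<in> sets lebesgue"
    using \<open>open \<Omega>\<close> by simp
  have key: "AE x in lebesgue. x \<in> box c d \<longrightarrow> h x = 0" if cd: "cbox c d \<subseteq> \<Omega>" for c d
  proof -
    define g where "g x = indicator (box c d) x *\<^sub>R h x" for x
    have cd': "box c d \<subseteq> cbox c d" "box c d \<subseteq> \<Omega>"
      using cd box_subset_cbox[of c d] by auto
    have g: "integrable lebesgue g"
    proof -
      have "integrable lebesgue (\<lambda>x. indicator \<Omega> x *\<^sub>R (indicator (cbox c d) x *\<^sub>R h x))"
        by (rule iffD1[OF integrable_restrict_space[OF \<Omega>] h[OF compact_cbox]])
      then have "integrable lebesgue (\<lambda>x. indicator (box c d) x *\<^sub>R (indicator \<Omega> x *\<^sub>R (indicator (cbox c d) x *\<^sub>R h x)))"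
        by (rule integrable_mult_indicator[rotated]) simp
      moreover have "(\<lambda>x. indicator (box c d) x *\<^sub>R (indicator \<Omega> x *\<^sub>R (indicator (cbox c d) x *\<^sub>R h x))) = g"
        using cd' by (auto simp: g_def fun_eq_iff indicator_def)
      ultimately show ?thesis
        by simp
    qed
    have sub: "(LINT x:box a b|lebesgue. g x) = 0" if ab: "cbox a b \<subseteq> cbox c d" for a b
    proof -
      have ab': "box a b \<subseteq> box c d"
        using interior_mono[OF ab] by simp
      have "(\<lambda>n. LINT x|lebesgue. box_bump a b (real (Suc n)) x *\<^sub>R g x)
          \<longlonglongrightarrow> (LINT x|lebesgue. indicator (box a b) x *\<^sub>R g x)"
      proof (rule integral_dominated_convergence)
        show "integrable lebesgue (\<lambda>x. norm (g x))"
          using g by simp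
        show "(\<lambda>x. indicator (box a b) x *\<^sub>R g x) \<in> borel_measurable lebesgue"
          using g by (intro borel_measurable_scaleR borel_measurable_indicator borel_measurable_integrable) auto
        have "box_bump a b s \<in> borel_measurable lebesgue" for s
          using smooth_continuous[OF smooth_box_bump, of a b s]
          by (intro measurable_completion) (simp add: borel_measurable_continuous_onI)
        then show "(\<lambda>x. box_bump a b (real (Suc n)) x *\<^sub>R g x) \<in> borel_measurable lebesgue" for n
          by (rule borel_measurable_scaleR[OF _ borel_measurable_integrable[OF g]])
        show "AE x in lebesgue. (\<lambda>n. box_bump a b (real (Suc n)) x *\<^sub>R g x) \<longlonglongrightarrow> indicator (box a b) x *\<^sub>R g x"
          by (intro AE_I2 tendsto_scaleR box_bump_tendsto_indicator tendsto_const)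
        show "AE x in lebesgue. norm (box_bump a b (real (Suc n)) x *\<^sub>R g x) \<le> norm (g x)" for n
          by (intro AE_I2) (simp add: box_bump_bounds mult_left_le_one_le)
      qed
      moreover have "(LINT x|lebesgue. box_bump a b (real (Suc n)) x *\<^sub>R g x) = 0" for n
      proof -
        have "test_function \<Omega> (\<lambda>x. of_real (box_bump a b (real (Suc n)) x))"
          using ab cd by (intro test_function_box_bump) auto
        then have "(LINT x|lebesgue_on \<Omega>. h x * of_real (box_bump a b (real (Suc n)) x)) = 0"
          by (rule orth)
        then have "(LINT x|lebesgue. indicator \<Omega> x *\<^sub>R (h x * of_real (box_bump a b (real (Suc n)) x))) = 0"
          by (simp only: integral_restrict_space[OF \<Omega>])
        moreover have "indicator \<Omega> x *\<^sub>R (h x * of_real (box_bump a b (real (Suc n)) x))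
            = box_bump a b (real (Suc n)) x *\<^sub>R g x" for x
        proof (cases "x \<in> box a b")
          case True
          then have "x \<in> box c d" "x \<in> \<Omega>"
            using ab' cd' by auto
          then show ?thesis
            by (simp add: g_def scaleR_conv_of_real mult.commute)
        next
          case False
          then have "box_bump a b (real (Suc n)) x = 0"
            by (subst box_bump_eq_0_iff) auto
          then show ?thesis
            by simp
        qed
        ultimately show ?thesis
          by simp
      qed
      ultimately show ?thesis
        unfolding set_lebesgue_integral_def by (simp add: LIMSEQ_const_iff)
    qed
    have box: "(LINT x:box a b|lebesgue. g x) = 0" for a b
    proof -
      \<comment> \<open>\<open>g\<close> vanishes outside \<open>box c d\<close>, so only the part of the box inside \<open>box c d\<close> matters; if it
          is nonempty, its closure is a closed box inside \<open>cbox c d\<close>.\<close>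
      obtain a' b' where ab: "box a b \<inter> box c d = box a' b'"
        by (simp add: box_Int_box)
      have "(LINT x:box a b|lebesgue. g x) = (LINT x:box a' b'|lebesgue. g x)"
        unfolding set_lebesgue_integral_def ab[symmetric]
        by (rule Bochner_Integration.integral_cong) (auto simp: g_def indicator_def)
      also have "\<dots> = 0"
      proof (cases "box a' b' = {}")
        case True
        then show ?thesis
          by (simp add: set_lebesgue_integral_def)
      next
        case False
        have "closure (box a' b') \<subseteq> cbox c d"
          using ab cd' by (intro closure_minimal) auto
        then show ?thesis
          using False by (intro sub) simp
      qed
      finally show ?thesis .
    qed
    have "(LINT x|lebesgue. g x) = (LINT x:box c d|lebesgue. g x)"
      unfolding set_lebesgue_integral_def
      by (rule Bochner_Integration.integral_cong) (auto simp: g_def indicator_def)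
    then have "AE x in lebesgue. g x = 0"
      using box by (intro AE_eq_0_if_box_integrals_eq_0 g) simp_all
    then show ?thesis
      by (rule AE_mp) (auto simp: g_def)
  qed
  define \<F> where "\<F> = {box c d | c d. cbox c d \<subseteq> \<Omega>}"
  obtain \<F>' where \<F>': "\<F>' \<subseteq> \<F>" "countable \<F>'" "\<Union>\<F>' = \<Union>\<F>"
    using Lindelof[of \<F>] by (auto simp: \<F>_def)
  have "\<Omega> \<subseteq> \<Union>\<F>"
  proof
    fix x assume "x \<in> \<Omega>"
    then obtain c d where "cbox c d \<subseteq> \<Omega>" "x \<in> box c d" "\<forall>i\<in>Basis. c \<bullet> i < d \<bullet> i"
      by (rule open_contains_cbox[OF \<open>open \<Omega>\<close>])
    then show "x \<in> \<Union>\<F>"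
      by (auto simp: \<F>_def)
  qed
  have "\<forall>B\<in>\<F>'. AE x in lebesgue. x \<in> B \<longrightarrow> h x = 0"
    using \<F>'(1) key by (auto simp: \<F>_def)
  then have "AE x in lebesgue. \<forall>B\<in>\<F>'. x \<in> B \<longrightarrow> h x = 0"
    by (rule iffD2[OF AE_ball_countable[OF \<F>'(2)]])
  then have "AE x in lebesgue. x \<in> \<Omega> \<longrightarrow> h x = 0"
  proof (rule AE_mp, intro AE_I2 impI)
    fix x assume *: "\<forall>B\<in>\<F>'. x \<in> B \<longrightarrow> h x = 0" "x \<in> \<Omega>"
    then obtain B where "B \<in> \<F>'" "x \<in> B"
      using \<open>\<Omega> \<subseteq> \<Union>\<F>\<close> \<F>'(3) by blast
    with * show "h x = 0"
      by blast
  qed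
  then show ?thesis
    by (simp add: AE_restrict_space_iff[OF \<Omega>])
qed

lemma is_weak_grad_unique:
  assumes "open \<Omega>" and g: "is_weak_grad \<Omega> u g" "is_weak_grad \<Omega> u g'"
  shows "AE x in lebesgue_on \<Omega>. g x = g' x"
proof -
  have comp: "integrable (lebesgue_on \<Omega>) (\<lambda>x. indicator K x *\<^sub>R (f x $ l))"
    if "is_weak_grad \<Omega> u f" "compact K" for f K l
  proof -
    have "integrable (lebesgue_on \<Omega>) (\<lambda>x. indicator K x *\<^sub>R f x)"
      using that by (intro L2_on_integrable_compact assms(1)) (simp_all add: is_weak_grad_def)
    from integrable_bounded_linear[OF bounded_linear_vec_nth this]
    show ?thesis
      by simp
  qed
  have "AE x in lebesgue_on \<Omega>. g x $ l - g' x $ l = 0" for l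
  proof (rule AE_eq_0_if_orthogonal_to_test_functions[OF assms(1)])
    show "integrable (lebesgue_on \<Omega>) (\<lambda>x. indicator K x *\<^sub>R (g x $ l - g' x $ l))" if "compact K" for K
      using comp[OF g(1) that] comp[OF g(2) that] by (simp add: scaleR_diff_right)
  next
    fix \<phi>
    assume \<phi>: "test_function \<Omega> \<phi>"
    have "integrable (lebesgue_on \<Omega>) (\<lambda>x. g x $ l * \<phi> x)" "integrable (lebesgue_on \<Omega>) (\<lambda>x. g' x $ l * \<phi> x)"
      by (intro integrable_test_mult[OF \<phi> _ assms(1)] comp g; assumption)+
    moreover have "- (LINT x|lebesgue_on \<Omega>. g x $ l * \<phi> x) = - (LINT x|lebesgue_on \<Omega>. g' x $ l * \<phi> x)"
      using g[unfolded is_weak_grad_def, THEN conjunct2, rule_format, OF \<phi>, of l] by (rule trans[OF sym])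
    ultimately show "(LINT x|lebesgue_on \<Omega>. (g x $ l - g' x $ l) * \<phi> x) = 0"
      by (simp add: left_diff_distrib)
  qed
  then have "AE x in lebesgue_on \<Omega>. \<forall>l\<in>UNIV. g x $ l - g' x $ l = 0"
    by (intro iffD2[OF AE_ball_countable] ballI) auto
  then show ?thesis
    by (rule AE_mp) (auto simp: vec_eq_iff)
qed

text \<open>The constant \<open>weak_grad\<close> is an arbitrary choice among the weak gradients; uniqueness is what ties
  it to the classical gradient, and makes \<open>I_fun\<close> computable on test functions.\<close>

lemma weak_grad_test_function:
  assumes "open \<Omega>" "test_function \<Omega> \<phi>"
  shows "AE x in lebesgue_on \<Omega>. weak_grad \<Omega> \<phi> x = grad \<phi> x"
proof (rule is_weak_grad_unique[OF assms(1)])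
  show "is_weak_grad \<Omega> \<phi> (grad \<phi>)"
    by (rule is_weak_grad_grad[OF assms])
  then show "is_weak_grad \<Omega> \<phi> (weak_grad \<Omega> \<phi>)"
    unfolding weak_grad_def by (rule someI[where P = "is_weak_grad \<Omega> \<phi>"])
qed

lemma test_function_in_H10:
  assumes "open \<Omega>" "test_function \<Omega> \<phi>"
  shows "\<phi> \<in> H10 \<Omega>"
proof -
  have "\<phi> \<in> H1 \<Omega>"
    using L2_on_test_function[OF assms] is_weak_grad_grad[OF assms] by (auto simp: H1_def)
  moreover have "(LINT x|lebesgue_on \<Omega>. (norm (weak_grad \<Omega> \<phi> x - grad \<phi> x))\<^sup>2) = 0"
    by (rule integral_eq_zero_AE, rule AE_mp[OF weak_grad_test_function[OF assms]]) simp
  ultimately show ?thesis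
    using assms(2) unfolding H10_def by (auto intro!: exI[of _ "\<lambda>_. \<phi>"])
qed

section \<open>The functionals on multiples of a test function\<close>

lemma L2_on_weak_grad: "u \<in> H1 \<Omega> \<Longrightarrow> L2_on \<Omega> (weak_grad \<Omega> u)"
proof -
  assume "u \<in> H1 \<Omega>"
  then obtain g where "is_weak_grad \<Omega> u g"
    by (auto simp: H1_def)
  then have "is_weak_grad \<Omega> u (weak_grad \<Omega> u)"
    unfolding weak_grad_def by (rule someI[where P = "is_weak_grad \<Omega> u"])
  then show ?thesis
    by (simp add: is_weak_grad_def)
qed

lemma H10_imp_H1: "u \<in> H10 \<Omega> \<Longrightarrow> u \<in> H1 \<Omega>"
  by (simp add: H10_def)

lemma I_fun_nonneg:
  assumes "\<And>i. \<omega> $ i > 0"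
  shows "I_fun \<Omega> \<omega> U \<ge> 0"
  unfolding I_fun_def using assms
  by (intro sum_nonneg Bochner_Integration.integral_nonneg) (simp add: less_imp_le)

lemma I_fun_le_0_imp_zero:
  fixes U :: "'m::finite \<Rightarrow> real^'n \<Rightarrow> complex"
  assumes \<omega>: "\<And>i. \<omega> $ i > 0" and U: "U \<in> H10_tuples \<Omega>" and I: "I_fun \<Omega> \<omega> U \<le> 0"
  shows "zero_on \<Omega> (U i)"
proof -
  let ?f = "\<lambda>i x. (norm (weak_grad \<Omega> (U i) x))\<^sup>2 + \<omega> $ i * (norm (U i x))\<^sup>2"
  have nonneg: "0 \<le> ?f i x" for i x
    using \<omega>[of i] by (simp add: less_imp_le)
  have "I_fun \<Omega> \<omega> U = 0"
    using I I_fun_nonneg[of \<omega> \<Omega> U, OF \<omega>] by simp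
  then have "(LINT x|lebesgue_on \<Omega>. ?f i x) = 0"
    unfolding I_fun_def using nonneg
    by (subst (asm) sum_nonneg_eq_0_iff) (auto intro!: Bochner_Integration.integral_nonneg)
  moreover have "integrable (lebesgue_on \<Omega>) (?f i)"
  proof -
    have H1: "U i \<in> H1 \<Omega>"
      using U by (simp add: H10_tuples_def H10_imp_H1)
    then have "L2_on \<Omega> (U i)"
      by (simp add: H1_def)
    then show ?thesis
      using L2_on_weak_grad[OF H1] by (simp add: L2_on_def)
  qed
  ultimately have "AE x in lebesgue_on \<Omega>. ?f i x = 0"
    using nonneg by (subst integral_nonneg_eq_0_iff_AE[symmetric]) auto
  moreover have "U i x = 0" if "?f i x = 0" for x
  proof -
    have "\<omega> $ i * (norm (U i x))\<^sup>2 \<le> 0"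
      using that zero_le_power2[of "norm (weak_grad \<Omega> (U i) x)"] by linarith
    then show ?thesis
      using \<omega>[of i] by (simp add: mult_le_0_iff)
  qed
  ultimately show ?thesis
    unfolding zero_on_def by (auto elim: AE_mp)
qed

text \<open>All components are equal to the same function: every product of two components is then the same, and one positive integral controls
  every coupling term of \<open>J_fun\<close>.\<close>

lemma I_fun_test_function:
  fixes \<omega> :: "real^'m"
  assumes "open \<Omega>" "test_function \<Omega> \<phi>"
  shows "I_fun \<Omega> \<omega> (\<lambda>i::'m::finite. \<phi>)
    = (\<Sum>i\<in>UNIV. LINT x|lebesgue_on \<Omega>. (norm (grad \<phi> x))\<^sup>2 + \<omega> $ i * (norm (\<phi> x))\<^sup>2)"
  unfolding I_fun_def
proof (rule sum.cong[OF refl], rule integral_cong_AE)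
  fix i
  have [measurable]: "\<phi> \<in> borel_measurable (lebesgue_on \<Omega>)" "grad \<phi> \<in> borel_measurable (lebesgue_on \<Omega>)"
    "weak_grad \<Omega> \<phi> \<in> borel_measurable (lebesgue_on \<Omega>)"
    using L2_on_test_function[OF assms] L2_on_weak_grad[OF H10_imp_H1[OF test_function_in_H10[OF assms]]]
    by (simp_all add: L2_on_def)
  show "(\<lambda>x. (norm (weak_grad \<Omega> \<phi> x))\<^sup>2 + \<omega> $ i * (norm (\<phi> x))\<^sup>2) \<in> borel_measurable (lebesgue_on \<Omega>)"
    "(\<lambda>x. (norm (grad \<phi> x))\<^sup>2 + \<omega> $ i * (norm (\<phi> x))\<^sup>2) \<in> borel_measurable (lebesgue_on \<Omega>)"
    by measurable
  show "AE x in lebesgue_on \<Omega>. (norm (weak_grad \<Omega> \<phi> x))\<^sup>2 + \<omega> $ i * (norm (\<phi> x))\<^sup>2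
      = (norm (grad \<phi> x))\<^sup>2 + \<omega> $ i * (norm (\<phi> x))\<^sup>2"
    by (rule AE_mp[OF weak_grad_test_function[OF assms]]) simp
qed

lemma I_fun_scaled_test_function:
  fixes \<omega> :: "real^'m" and t :: real
  assumes "open \<Omega>" "test_function \<Omega> \<phi>"
  shows "I_fun \<Omega> \<omega> (\<lambda>(i::'m::finite) x. of_real t * \<phi> x) = t\<^sup>2 * I_fun \<Omega> \<omega> (\<lambda>i::'m. \<phi>)"
proof -
  have "smooth \<phi>"
    using assms(2) by (simp add: test_function_def)
  then have "grad (\<lambda>x. of_real t * \<phi> x) x = t *\<^sub>R grad \<phi> x" for x
    unfolding grad_cmult[OF \<open>smooth \<phi>\<close>] by (simp add: vec_eq_iff scaleR_conv_of_real[symmetric])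
  then have "(norm (grad (\<lambda>x. of_real t * \<phi> x) x))\<^sup>2 + \<omega> $ i * (norm (of_real t * \<phi> x))\<^sup>2
      = t\<^sup>2 * ((norm (grad \<phi> x))\<^sup>2 + \<omega> $ i * (norm (\<phi> x))\<^sup>2)" for i x
    by (simp add: norm_mult power_mult_distrib algebra_simps)
  then show ?thesis
    using I_fun_test_function[OF assms(1) test_function_cmult[OF assms(2), of "of_real t"], of \<omega>]
      I_fun_test_function[OF assms, of \<omega>]
    by (simp add: sum_distrib_left)
qed

lemma J_fun_scaled:
  assumes "0 \<le> t"
  shows "J_fun \<Omega> p A (\<lambda>i x. of_real t * U i x) = t powr (2 * p + 2) * J_fun \<Omega> p A U"
proof -
  have *: "norm (of_real t * U i x) powr (p + 1) * norm (of_real t * U j x) powr (p + 1)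
      = t powr (2 * p + 2) * (norm (U i x) powr (p + 1) * norm (U j x) powr (p + 1))" for i j x
  proof -
    have "t powr (2 * p + 2) = t powr (p + 1) * t powr (p + 1)"
      by (simp add: powr_add[symmetric])
    then show ?thesis
      using assms by (simp add: norm_mult powr_mult)
  qed
  show ?thesis
    unfolding J_fun_def * integral_mult_right_zero by (simp add: sum_distrib_left case_prod_beta mult.left_commute)
qed

text \<open>The tuple is rescaled by the \<open>t\<close> for which \<open>J_fun\<close> becomes \<open>1\<close>. Since \<open>I_fun\<close> is homogeneous of
  degree \<open>2\<close> and \<open>J_fun\<close> of degree \<open>2p + 2\<close>, the infimum is at most \<open>I_fun\<close> times \<open>J_fun\<close> to the power
  \<open>-1/(p+1)\<close>; the outer exponent \<open>(p+1)/p\<close> turns this into \<open>-1/p\<close>, which is negative. So a tuple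
  with bounded \<open>I_fun\<close> and large \<open>J_fun\<close> forces a small level.\<close>

lemma min_level_le_test_function:
  fixes \<omega> :: "real^'m" and A :: "real^'m^'m"
  assumes "open \<Omega>" "test_function \<Omega> \<phi>" "0 < p" and \<omega>: "\<And>i. \<omega> $ i > 0"
    and J: "J_fun \<Omega> p A (\<lambda>i::'m::finite. \<phi>) > 0"
  shows "min_level \<Omega> \<omega> p A
    \<le> I_fun \<Omega> \<omega> (\<lambda>i::'m. \<phi>) powr ((p + 1) / p) * J_fun \<Omega> p A (\<lambda>i::'m. \<phi>) powr (- 1 / p)"
proof -
  define j where "j = J_fun \<Omega> p A (\<lambda>i::'m. \<phi>)"
  define t where "t = j powr (- 1 / (2 * p + 2))"
  define W where "W = (\<lambda>(i::'m) x. of_real t * \<phi> x)"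
  let ?S = "{W \<in> H10_tuples \<Omega>. J_fun \<Omega> p A W = 1}"
  have "j > 0"
    using J by (simp add: j_def)
  have "t powr (2 * p + 2) = j powr (- 1 / (2 * p + 2) * (2 * p + 2))"
    by (simp only: t_def powr_powr)
  also have "- 1 / (2 * p + 2) * (2 * p + 2) = - 1"
    using \<open>0 < p\<close> by simp
  finally have "t powr (2 * p + 2) = 1 / j"
    using \<open>j > 0\<close> by (simp add: powr_minus_divide)
  then have "J_fun \<Omega> p A W = 1"
    using J_fun_scaled[of t \<Omega> p A "\<lambda>i. \<phi>"] \<open>j > 0\<close> by (simp add: W_def j_def[symmetric] t_def)
  moreover have "W \<in> H10_tuples \<Omega>"
    using test_function_in_H10[OF assms(1) test_function_cmult[OF assms(2)]]
    by (simp add: H10_tuples_def W_def)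
  ultimately have W: "W \<in> ?S"
    by simp
  have "t\<^sup>2 = j powr (- 1 / (p + 1))"
  proof -
    have "t\<^sup>2 = j powr (- 1 / (2 * p + 2) + - 1 / (2 * p + 2))"
      by (simp only: t_def power2_eq_square powr_add)
    also have "- 1 / (2 * p + 2) + - 1 / (2 * p + 2) = - 1 / (p + 1)"
      using \<open>0 < p\<close> by (simp add: field_simps)
    finally show ?thesis .
  qed
  then have IW: "I_fun \<Omega> \<omega> W = j powr (- 1 / (p + 1)) * I_fun \<Omega> \<omega> (\<lambda>i. \<phi>)"
    using I_fun_scaled_test_function[OF assms(1,2), of \<omega> t] by (simp add: W_def)
  have "(INF W \<in> ?S. I_fun \<Omega> \<omega> W) \<le> I_fun \<Omega> \<omega> W"
    using W I_fun_nonneg[of \<omega>, OF \<omega>] by (intro cINF_lower bdd_belowI2[where m = 0]) auto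
  moreover have "0 \<le> (INF W \<in> ?S. I_fun \<Omega> \<omega> W)"
    using W I_fun_nonneg[of \<omega>, OF \<omega>] by (intro cINF_greatest) auto
  ultimately have "min_level \<Omega> \<omega> p A \<le> I_fun \<Omega> \<omega> W powr ((p + 1) / p)"
    unfolding min_level_def using \<open>0 < p\<close> by (intro powr_mono2) auto
  also have "\<dots> = I_fun \<Omega> \<omega> (\<lambda>i. \<phi>) powr ((p + 1) / p) * j powr (- 1 / (p + 1) * ((p + 1) / p))"
    unfolding IW using I_fun_nonneg[of \<omega>, OF \<omega>] by (simp add: powr_mult powr_powr)
  also have "- 1 / (p + 1) * ((p + 1) / p) = - 1 / p"
    using \<open>0 < p\<close> by simp
  finally show ?thesis
    by (simp add: j_def)
qed

lemma ex_test_function_positive_integral: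
  fixes \<Omega> :: "(real^'n) set"
  assumes "open \<Omega>" "\<Omega> \<noteq> {}" "0 < p"
  obtains \<phi> where "test_function \<Omega> \<phi>"
    "(LINT x|lebesgue_on \<Omega>. norm (\<phi> x) powr (p + 1) * norm (\<phi> x) powr (p + 1)) > 0"
proof -
  obtain x0 where "x0 \<in> \<Omega>"
    using assms(2) by blast
  then obtain a b where ab: "cbox a b \<subseteq> \<Omega>" "x0 \<in> box a b" "\<forall>i\<in>Basis. a \<bullet> i < b \<bullet> i"
    by (rule open_contains_cbox[OF \<open>open \<Omega>\<close>])
  define \<phi> where "\<phi> x = complex_of_real (box_bump a b 1 x)" for x
  have \<phi>: "test_function \<Omega> \<phi>"
    using test_function_box_bump[OF ab(1), of 1] by (simp add: \<phi>_def[abs_def])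
  let ?f = "\<lambda>x. norm (\<phi> x) powr (p + 1) * norm (\<phi> x) powr (p + 1)"
  have zero: "?f x = 0 \<longleftrightarrow> x \<notin> box a b" for x
    using box_bump_eq_0_iff[of 1 a b x] by (auto simp: \<phi>_def)
  have contf: "continuous_on UNIV ?f"
    using \<open>0 < p\<close> smooth_continuous[of \<phi>] \<phi>
    by (auto simp: test_function_def intro!: continuous_on_mult continuous_on_powr' continuous_on_norm continuous_on_const)
  have f0: "?f x = 0" if "x \<notin> \<Omega>" for x
    using that ab(1) zero box_subset_cbox[of a b] by blast
  have int: "integrable lborel ?f"
    by (rule integrable_continuous_compact_support[OF contf compact_cbox[of a b]])
      (use zero box_subset_cbox[of a b] in blast)
  have "(LINT x|lborel. ?f x) \<noteq> 0"
  proof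
    assume "(LINT x|lborel. ?f x) = 0"
    then have "AE x in lborel. ?f x = 0"
      using integral_nonneg_eq_0_iff_AE[OF int] by auto
    then have "AE x in lborel. x \<notin> box a b"
      by (simp only: zero)
    then have "box a b \<in> null_sets lborel"
      by (simp add: AE_iff_null_sets[symmetric])
    then have "emeasure lborel (box a b) = 0"
      by auto
    moreover have "emeasure lborel (box a b) = ennreal (\<Prod>i\<in>Basis. (b - a) \<bullet> i)"
      using ab(3) by (intro emeasure_lborel_box) (simp add: less_imp_le)
    moreover have "(\<Prod>i\<in>Basis. (b - a) \<bullet> i) > 0"
      using ab(3) by (intro prod_pos ballI) (simp add: inner_diff_left)
    ultimately show False
      by (simp add: ennreal_eq_0_iff del: emeasure_lborel_box)
  qed
  moreover have "(LINT x|lborel. ?f x) \<ge> 0"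
    by (intro Bochner_Integration.integral_nonneg) simp
  ultimately have "(LINT x|lborel. ?f x) > 0"
    by linarith
  then have "(LINT x|lebesgue_on \<Omega>. ?f x) > 0"
    using lebesgue_on_open_zero_outside(1)[OF assms(1) borel_measurable_continuous_onI[OF contf] f0] by simp
  with \<phi> show ?thesis
    by (rule that)
qed

text \<open>The pairs in \<open>P\<close>, the only ones that feel \<open>\<beta>\<close>, contribute integrals of functions that vanish
  almost everywhere.\<close>

lemma J_fun_beta_coupling_disjoint:
  fixes P :: "('m::finite \<times> 'm) set"
  assumes "\<And>i j. (i, j) \<in> P \<Longrightarrow> zero_on \<Omega> (\<lambda>x. U i x * U j x)"
  shows "J_fun \<Omega> p (beta_coupling K P \<beta>) U = J_fun \<Omega> p (beta_coupling K P 0) U"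
proof -
  have "(LINT x|lebesgue_on \<Omega>. norm (U i x) powr (p + 1) * norm (U j x) powr (p + 1)) = 0"
    if "(i, j) \<in> P" for i j
    using assms[OF that] unfolding zero_on_def by (intro integral_eq_zero_AE) (auto elim: AE_mp)
  then have "(\<Sum>(i,j)\<in>P. K $ i $ j *
      (LINT x|lebesgue_on \<Omega>. norm (U i x) powr (p + 1) * norm (U j x) powr (p + 1))) = 0"
    by (intro sum.neutral) auto
  then show ?thesis
    by (simp add: J_fun_beta_coupling)
qed

section \<open>Large coupling excludes the given bound state\<close>

theorem proposition5:
  fixes \<Omega> :: "(real^'n) set"
    and p :: real
    and \<omega> :: "real^'m"
    and K :: "real^'m^'m"
    and U :: "'m::finite \<Rightarrow> real^'n \<Rightarrow> complex"
    and P :: "('m \<times> 'm) set"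
  assumes "CARD('m) \<ge> 2"
    and "open \<Omega>" and "smooth_boundary \<Omega>"
    and "0 < p" and "ereal p < critical_exponent CARD('n)"
    and "\<And>i. \<omega> $ i > 0"
    and "transpose K = K"
    and "semitrivial_bound_state \<Omega> \<omega> p K U"
    and "P \<noteq> {}" and "sym P"
    and "\<And>i j. (i, j) \<in> P \<Longrightarrow> K $ i $ j > 0"
    and "\<And>i j. (i, j) \<in> P \<Longrightarrow> zero_on \<Omega> (\<lambda>x. U i x * U j x)"
    and standing_fact:
      "\<And>\<beta>. \<lbrakk>\<exists>W :: 'm \<Rightarrow> real^'n \<Rightarrow> complex. W \<in> H10_tuples \<Omega> \<and> J_fun \<Omega> p (beta_coupling K P \<beta>) W > 0;
             ground_states \<Omega> \<omega> p (beta_coupling K P \<beta>) \<noteq> {}\<rbrakk>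
        \<Longrightarrow> ground_states \<Omega> \<omega> p (beta_coupling K P \<beta>)
            = constrained_minimizers \<Omega> \<omega> p (beta_coupling K P \<beta>)"
  shows "\<exists>\<beta>0. \<forall>\<beta>>\<beta>0. U \<notin> ground_states \<Omega> \<omega> p (beta_coupling K P \<beta>)"
proof -
  have nonzero: "\<not> (\<forall>i. zero_on \<Omega> (U i))"
    using assms(8) by (simp add: semitrivial_bound_state_def bound_state_def)
  then have "\<Omega> \<noteq> {}"
    by (auto simp: zero_on_def intro: AE_I2)
  then obtain \<phi> where \<phi>: "test_function \<Omega> \<phi>"
    and pos: "(LINT x|lebesgue_on \<Omega>. norm (\<phi> x) powr (p + 1) * norm (\<phi> x) powr (p + 1)) > 0" (is "?a > 0")
    using ex_test_function_positive_integral[OF \<open>open \<Omega>\<close> _ \<open>0 < p\<close>] by metis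
  let ?A = "\<lambda>\<beta>. beta_coupling K P \<beta>"
  define W where "W = (\<lambda>i::'m. \<phi>)"
  define c where "c = J_fun \<Omega> p (?A 0) U"
  have W: "W \<in> H10_tuples \<Omega>"
    using test_function_in_H10[OF \<open>open \<Omega>\<close> \<phi>] by (simp add: W_def H10_tuples_def)
  have JU: "J_fun \<Omega> p (?A \<beta>) U = c" for \<beta>
    unfolding c_def by (rule J_fun_beta_coupling_disjoint) (rule assms(12))
  define kP where "kP = (\<Sum>(i,j)\<in>P. K $ i $ j * ?a)"
  define kN where "kN = (\<Sum>(i,j)\<in>-P. K $ i $ j * ?a)"
  have "kP > 0"
    unfolding kP_def using assms(9,11) pos by (intro sum_pos) auto
  have JW: "J_fun \<Omega> p (?A \<beta>) W = kN + \<beta> * kP" for \<beta>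
    by (simp add: J_fun_beta_coupling W_def kN_def kP_def)
  have lim: "filterlim (\<lambda>\<beta>. J_fun \<Omega> p (?A \<beta>) W) at_top at_top"
    unfolding JW
    by (intro filterlim_tendsto_add_at_top[OF tendsto_const] filterlim_at_top_mult_tendsto_pos[OF tendsto_const \<open>kP > 0\<close>] filterlim_ident)
  \<comment> \<open>The standing fact applies once \<open>J_fun\<close> takes a positive value somewhere.\<close>
  have ev1: "eventually (\<lambda>\<beta>. J_fun \<Omega> p (?A \<beta>) W > 0) at_top"
    using lim by (simp add: filterlim_at_top_dense)
  have "((\<lambda>\<beta>. I_fun \<Omega> \<omega> W powr ((p + 1) / p) * J_fun \<Omega> p (?A \<beta>) W powr (- 1 / p)) \<longlongrightarrow>
      I_fun \<Omega> \<omega> W powr ((p + 1) / p) * 0) at_top"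
    using \<open>0 < p\<close> lim by (intro tendsto_mult tendsto_const tendsto_neg_powr) auto
  then have ev2: "eventually (\<lambda>\<beta>. c > 0 \<longrightarrow> I_fun \<Omega> \<omega> W powr ((p + 1) / p) * J_fun \<Omega> p (?A \<beta>) W powr (- 1 / p) < c) at_top"
    by (cases "c > 0") (auto dest: order_tendstoD)
  have "eventually (\<lambda>\<beta>. U \<notin> ground_states \<Omega> \<omega> p (?A \<beta>)) at_top"
    using ev1 ev2
  proof eventually_elim
    case (elim \<beta>)
    show ?case
    proof
      assume U: "U \<in> ground_states \<Omega> \<omega> p (?A \<beta>)"
      then have "U \<in> constrained_minimizers \<Omega> \<omega> p (?A \<beta>)"
        using standing_fact[of \<beta>] W elim(1) by blast
      then have UH: "U \<in> H10_tuples \<Omega>" and level: "min_level \<Omega> \<omega> p (?A \<beta>) = c"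
        and minimal: "\<And>V. V \<in> H10_tuples \<Omega> \<Longrightarrow> J_fun \<Omega> p (?A \<beta>) V = c \<Longrightarrow> I_fun \<Omega> \<omega> U \<le> I_fun \<Omega> \<omega> V"
        using JU[of \<beta>] by (auto simp: constrained_minimizers_def)
      \<comment> \<open>A level, being a power, is nonnegative, and the choice of \<open>\<beta>\<close> excludes a positive \<open>c\<close>. It
          remains to refute \<open>c = 0\<close>, where the zero tuple becomes a competitor.\<close>
      have "c \<ge> 0"
        unfolding level[symmetric] min_level_def by simp
      moreover have "\<not> c > 0"
        using min_level_le_test_function[OF \<open>open \<Omega>\<close> \<phi> \<open>0 < p\<close> assms(6), of "?A \<beta>"] elim level
        by (auto simp: W_def)
      ultimately have "c = 0"
        by simp
      define Z where "Z = (\<lambda>(i::'m) x. of_real 0 * \<phi> x)"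
      have "Z \<in> H10_tuples \<Omega>"
        using test_function_in_H10[OF \<open>open \<Omega>\<close> test_function_cmult[OF \<phi>]]
        by (simp add: Z_def H10_tuples_def del: of_real_0 mult_zero_left)
      moreover have "J_fun \<Omega> p (?A \<beta>) Z = c"
        using J_fun_scaled[of 0 \<Omega> p "?A \<beta>" W] \<open>c = 0\<close> \<open>0 < p\<close> by (simp add: Z_def W_def)
      ultimately have "I_fun \<Omega> \<omega> U \<le> I_fun \<Omega> \<omega> Z"
        by (rule minimal)
      also have "\<dots> = 0"
        using I_fun_scaled_test_function[OF \<open>open \<Omega>\<close> \<phi>, of \<omega> 0] by (simp add: Z_def)
      finally show False
        using nonzero I_fun_le_0_imp_zero[OF assms(6) UH] by blast
    qed
  qed
  then show ?thesis
    by (simp add: eventually_at_top_dense)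
qed

end
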